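(* Let $(\varepsilon_i)_{i\in\mathbb Z}$ be an i.i.d. sequence with values in $\mathbb R^d$, let $h\colon\mathbb R^d\times\mathbb R^d\to\mathbb R$ be a measurable symmetric function (that is, $h(x,y)=h(y,x)$), and let $1\le p<2$. Put $U_n=\sum_{1\le i<j\le n}h(\varepsilon_i,\varepsilon_j)$ and $$M_p:=\sup_{n\ge1}\frac{1}{n^{2/p}}|U_n|.$$ Assume that $\mathbb E[|h(\varepsilon_0,\varepsilon_1)|^p]$ is finite and that $\mathbb E[h(\varepsilon_0,x)]=0$ for all $x\in\mathbb R^d$. Then: (1) the sequence $(n^{-2/p}|U_n|)_{n\ge1}$ converges to zero almost surely; (2) for every $x>0$, $$x^p\,\mathbb P\{M_p>x\}\le\kappa_p\,\mathbb E[|h(\varepsilon_0,\varepsilon_1)|^p],$$ where $\kappa_p\geq 1$ depends only on $p$. *)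

theory Defs
  imports "HOL-Probability.Probability"
begin

definition U_stat :: "('b \<Rightarrow> 'b \<Rightarrow> real) \<Rightarrow> (int \<Rightarrow> 'a \<Rightarrow> 'b) \<Rightarrow> nat \<Rightarrow> 'a \<Rightarrow> real" where
  "U_stat h \<epsilon> n \<omega> = (\<Sum>(i, j) \<in> {(i, j). 1 \<le> i \<and> i < j \<and> j \<le> int n}. h (\<epsilon> i \<omega>) (\<epsilon> j \<omega>))"

text \<open>The supremum is taken in the extended reals, since it may be infinite.\<close>

definition U_max :: "real \<Rightarrow> ('b \<Rightarrow> 'b \<Rightarrow> real) \<Rightarrow> (int \<Rightarrow> 'a \<Rightarrow> 'b) \<Rightarrow> 'a \<Rightarrow> ereal" where
  "U_max p h \<epsilon> \<omega> = (SUP n\<in>{1..}. ereal (\<bar>U_stat h \<epsilon> n \<omega>\<bar> / real n powr (2 / p)))"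

text \<open>
  The constant in the weak-type inequality depends on \<open>p\<close> only: neither on the dimension, nor on
  the probability space, nor on the sequence and the kernel. An existential quantifier inside a
  theorem about \<open>\<epsilon> :: int \<Rightarrow> 'a \<Rightarrow> real ^ 'n\<close> would let it depend on the types \<open>'a\<close> and \<open>'n\<close>, and
  HOL cannot quantify over these below the existential. So the constant is a closed term of
  type \<open>real \<Rightarrow> real\<close>, obtained by choosing a constant that works for all dimensions \<open>d\<close>, all
  laws \<open>\<mu>\<close> on \<open>d\<close>-dimensional space (realised as functions on \<open>{..<d}\<close>) and all kernels, when
  \<open>\<epsilon>\<close> is the sequence of coordinates on the infinite product of copies of \<open>\<mu>\<close>. The choice carries
  no information by itself: \<open>weak_type_const p\<close> is unspecified unless such a constant exists.
\<close>

definition is_weak_type_const :: "real \<Rightarrow> real \<Rightarrow> bool" where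
  "is_weak_type_const p \<kappa> \<longleftrightarrow> \<kappa> \<ge> 1 \<and>
    (\<forall>(d::nat) (\<mu> :: (nat \<Rightarrow> real) measure) (h :: (nat \<Rightarrow> real) \<Rightarrow> (nat \<Rightarrow> real) \<Rightarrow> real).
      d \<ge> 1 \<longrightarrow> prob_space \<mu> \<longrightarrow> sets \<mu> = sets (\<Pi>\<^sub>M k\<in>{..<d}. borel) \<longrightarrow>
      (\<lambda>(x, y). h x y) \<in> borel_measurable (\<mu> \<Otimes>\<^sub>M \<mu>) \<longrightarrow>
      (\<forall>x\<in>space \<mu>. \<forall>y\<in>space \<mu>. h x y = h y x) \<longrightarrow>
      integrable (\<Pi>\<^sub>M i\<in>(UNIV::int set). \<mu>) (\<lambda>\<omega>. \<bar>h (\<omega> 0) (\<omega> 1)\<bar> powr p) \<longrightarrow>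
      (\<forall>x\<in>space \<mu>. integrable (\<Pi>\<^sub>M i\<in>(UNIV::int set). \<mu>) (\<lambda>\<omega>. h (\<omega> 0) x) \<and>
                   integral\<^sup>L (\<Pi>\<^sub>M i\<in>(UNIV::int set). \<mu>) (\<lambda>\<omega>. h (\<omega> 0) x) = 0) \<longrightarrow>
      (\<forall>t>0. t powr p *
          measure (\<Pi>\<^sub>M i\<in>(UNIV::int set). \<mu>)
            {\<omega> \<in> space (\<Pi>\<^sub>M i\<in>(UNIV::int set). \<mu>). U_max p h (\<lambda>i \<omega>. \<omega> i) \<omega> > ereal t}
        \<le> \<kappa> * integral\<^sup>L (\<Pi>\<^sub>M i\<in>(UNIV::int set). \<mu>) (\<lambda>\<omega>. \<bar>h (\<omega> 0) (\<omega> 1)\<bar> powr p)))"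

definition weak_type_const :: "real \<Rightarrow> real" where
  "weak_type_const p = (SOME \<kappa>. is_weak_type_const p \<kappa>)"

end

theory Submission
  imports Defs
begin

text \<open>
  For \<open>1 < p < 2\<close>, consider the block \<open>2^N \<le> n \<le> 2^(N+1)\<close> and the level \<open>c = x 4^(N/p)\<close>. Truncate \<open>h\<close> at
  \<open>c\<close> and project the result onto degenerate kernels; call this \<open>k\<close>. Since \<open>U\<^sub>n\<close> built from \<open>k\<close> is a
  square integrable martingale, Kolmogorov's inequality bounds its maximum over the block by
  \<open>4^N E[h\<^sup>2; \<bar>h\<bar> \<le> c] / c\<^sup>2\<close>, while degeneracy of \<open>h\<close> gives \<open>E\<bar>h - k\<bar> \<le> 4 E[\<bar>h\<bar>; \<bar>h\<bar> > c]\<close>, and the remainder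
  is handled by Markov's inequality. Both bounds, summed over \<open>N\<close>, are geometric series dominated by
  \<open>E\<bar>h\<bar>^p / x^p\<close>. This yields the weak-type inequality and, by Borel-Cantelli, the convergence.

  For \<open>p = 1\<close> the second series diverges logarithmically. There the inequality follows from
  exchangeability alone, and convergence from approximating \<open>h\<close> in \<open>L\<^sup>1\<close> by bounded degenerate kernels,
  to which the case \<open>p = 3/2\<close> applies.
\<close>

section \<open>Series and index sets\<close>

text \<open>Truncation destroys degeneracy, and without degeneracy the variance of U_n is in general
  of order n^3 instead of n^2; hence the projection. It costs little because \<open>h\<close>
  integrates to 0 in each variable: the means removed from the truncated kernel are, up to sign,
  means of the discarded tail. The level \<open>c\<close> is the least value of
  \<open>x * n powr (2 / p)\<close> on the block, so one level serves every \<open>n\<close> in it.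
  From one block to the next the two bounds grow by the factors 4^((p-2)/p) < 1 and 4^((p-1)/p) > 1;
  at a given point the first is summed over the blocks whose level is at least |h|, the second over
  those whose level is below |h|. At p = 1 the second factor is 1. No filtration appears.
  Overwriting one coordinate with an independent copy preserves the product law, and a function is
  adapted when it ignores the overwriting. All estimates are proved on the product of copies of an
  arbitrary probability space and reach a given sequence through its law. This also suits the
  constant, which is a closed term about laws on \<open>nat \<Rightarrow> real\<close>.\<close>

lemma sum_power_below_le:
  fixes r Y :: real
  assumes "1 < r" "0 \<le> Y" "\<And>N. P N \<Longrightarrow> r ^ N \<le> Y"
  shows "(\<Sum>N<K. if P N then r ^ N else 0) \<le> Y / (1 - 1 / r)"
proof (induction K)
  case 0
  then show ?case using assms by simp
next
  case (Suc K)
  show ?case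
  proof (cases "P K")
    case True
    have "(\<Sum>N<Suc K. if P N then r ^ N else 0) \<le> (\<Sum>N<Suc K. r ^ N)"
      using assms by (intro sum_mono) auto
    also have "\<dots> = (r ^ Suc K - 1) / (r - 1)"
      using assms by (subst geometric_sum) auto
    also have "\<dots> \<le> r ^ Suc K / (r - 1)"
      using assms by (intro divide_right_mono) auto
    also have "\<dots> = r ^ K / (1 - 1 / r)"
      using assms by (simp add: field_simps)
    also have "\<dots> \<le> Y / (1 - 1 / r)"
      using assms True by (intro divide_right_mono) auto
    finally show ?thesis .
  next
    case False
    then show ?thesis using Suc by simp
  qed
qed

text \<open>A geometric sum is dominated by its largest term: here the first \<open>N\<close> with
  \<open>P N\<close>, for a ratio above 1 the last one. When \<open>P 0\<close> fails, the predicate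
  is shifted by one and \<open>Y\<close> becomes \<open>Y / r\<close>, so the induction generalises
  over both.\<close>

lemma sum_power_above_le:
  fixes r Y :: real
  assumes "0 < r" "r < 1" "0 \<le> Y" "\<And>N. P N \<Longrightarrow> r ^ N \<le> Y"
  shows "(\<Sum>N<K. if P N then r ^ N else 0) \<le> Y / (1 - r)"
  using assms(3,4)
proof (induction K arbitrary: P Y)
  case 0
  then show ?case using assms by simp
next
  case (Suc K)
  show ?case
  proof (cases "P 0")
    case True
    have "(\<Sum>N<Suc K. if P N then r ^ N else 0) \<le> (\<Sum>N<Suc K. r ^ N)"
      using assms(1,2) by (intro sum_mono) auto
    also have "\<dots> = (1 - r ^ Suc K) / (1 - r)"
      using assms(1,2) by (subst sum_gp_strict) auto
    also have "\<dots> \<le> Y / (1 - r)"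
      using assms(1,2) Suc.prems(2)[OF True] by (intro divide_right_mono) (auto intro: order_trans[of _ 1])
    finally show ?thesis .
  next
    case False
    have "r ^ N \<le> Y / r" if "P (Suc N)" for N
      using Suc.prems(2)[OF that] assms(1) by (simp add: field_simps)
    then have "(\<Sum>N<K. if P (Suc N) then r ^ N else 0) \<le> Y / r / (1 - r)"
      using Suc.IH[of "Y / r" "\<lambda>N. P (Suc N)"] Suc.prems assms(1) by simp
    then have "r * (\<Sum>N<K. if P (Suc N) then r ^ N else 0) \<le> r * (Y / r / (1 - r))"
      using assms(1) by (intro mult_left_mono) auto
    also have "\<dots> = Y / (1 - r)" using assms(1) by simp
    also have "r * (\<Sum>N<K. if P (Suc N) then r ^ N else 0) = (\<Sum>N<K. if P (Suc N) then r ^ Suc N else 0)"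
      unfolding sum_distrib_left by (intro sum.cong) auto
    finally show ?thesis using False by (subst sum.lessThan_Suc_shift) simp
  qed
qed

text \<open>The denominators come from the two geometric series. The numerators are the constants 4
  and 32 of the truncation bound, times 4, because a block ends at \<open>2 ^ Suc N\<close>, whose
  square is \<open>4 * 4 ^ N\<close>.\<close>

definition block_const :: "real \<Rightarrow> real" where
  "block_const p = 16 / (1 - 1 / 4 powr ((p - 1) / p)) + 128 / (1 - 4 powr ((p - 2) / p))"

text \<open>Pointwise form of the sum over blocks, with \<open>H\<close> standing for |h| / x at one
  point. Since \<open>b N powr p = 4 ^ N\<close>, the weights are multiples of
  \<open>b N powr (p - 2)\<close> and \<open>b N powr (p - 1)\<close>. Comparing \<open>b N\<close>
  with \<open>H\<close> bounds those that occur by \<open>H powr (p - 2)\<close> and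
  \<open>H powr (p - 1)\<close>, and the factors \<open>H\<^sup>2\<close> and \<open>H\<close>
  complete the power.\<close>

lemma sum_truncation_le:
  fixes p H :: real
  assumes p: "1 < p" "p < 2" and "0 \<le> H"
  defines "b \<equiv> \<lambda>N. 4 powr (real N / p)"
  shows "(\<Sum>N<K. 128 * (4 ^ N / (b N)\<^sup>2) * (if H > b N then 0 else H\<^sup>2) +
                  16 * (4 ^ N / b N) * (if H > b N then H else 0)) \<le> block_const p * H powr p"
proof (cases "H = 0")
  case True
  then show ?thesis by (simp add: b_def)
next
  case False
  then have "H > 0" using \<open>0 \<le> H\<close> by simp
  define r1 where "r1 = (4::real) powr ((p - 1) / p)"
  define r2 where "r2 = (4::real) powr ((p - 2) / p)"
  have r1: "1 < r1" unfolding r1_def using p by (intro gr_one_powr) auto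
  have r2: "0 < r2" "r2 < 1" unfolding r2_def using p by (auto simp: divide_less_0_iff powr_less_one)
  have four: "(4::real) ^ N = 4 powr real N" for N by (simp add: powr_realpow)
  have b1: "4 ^ N / b N = r1 ^ N" "b N powr (p - 1) = r1 ^ N" for N
  proof -
    have "r1 ^ N = 4 powr ((p - 1) / p * real N)"
      unfolding r1_def by (simp add: powr_realpow[symmetric] powr_powr)
    also have "(p - 1) / p * real N = real N - real N / p"
      using p by (simp add: field_simps)
    finally show "4 ^ N / b N = r1 ^ N" "b N powr (p - 1) = r1 ^ N"
      unfolding four b_def powr_powr using p by (auto simp: powr_diff[symmetric] field_simps)
  qed
  have b2: "4 ^ N / (b N)\<^sup>2 = r2 ^ N" "b N powr (p - 2) = r2 ^ N" for N
  proof -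
    have "r2 ^ N = 4 powr ((p - 2) / p * real N)"
      unfolding r2_def by (simp add: powr_realpow[symmetric] powr_powr)
    also have e: "(p - 2) / p * real N = real N - real N / p * 2"
      using p by (simp add: field_simps)
    finally have r: "r2 ^ N = 4 powr (real N - real N / p * 2)" .
    have "(b N)\<^sup>2 = b N powr 2" by (simp add: b_def)
    then have "(b N)\<^sup>2 = 4 powr (real N / p * 2)" by (simp only: b_def powr_powr)
    then show "4 ^ N / (b N)\<^sup>2 = r2 ^ N" by (simp only: r four powr_diff)
    have "real N / p * (p - 2) = real N - real N / p * 2" using p by (simp add: field_simps)
    then show "b N powr (p - 2) = r2 ^ N" by (simp only: b_def powr_powr r)
  qed
  have "b N > 0" for N by (simp add: b_def)
  have S1: "(\<Sum>N<K. if H > b N then r1 ^ N else 0) \<le> H powr (p - 1) / (1 - 1 / r1)"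
  proof (rule sum_power_below_le[OF r1])
    show "r1 ^ N \<le> H powr (p - 1)" if "H > b N" for N
      unfolding b1(2)[symmetric] using p \<open>b N > 0\<close> that by (intro powr_mono2) auto
  qed simp
  have S2: "(\<Sum>N<K. if \<not> H > b N then r2 ^ N else 0) \<le> H powr (p - 2) / (1 - r2)"
  proof (rule sum_power_above_le[OF r2])
    \<comment> \<open>The exponent \<open>p - 2\<close> is negative, so \<open>H \<le> b N\<close>
      reverses when powers are taken.\<close>
    show "r2 ^ N \<le> H powr (p - 2)" if "\<not> H > b N" for N
      unfolding b2(2)[symmetric] using p \<open>H > 0\<close> that by (intro powr_mono2') auto
  qed simp
  have "(\<Sum>N<K. 128 * (4 ^ N / (b N)\<^sup>2) * (if H > b N then 0 else H\<^sup>2) +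
                  16 * (4 ^ N / b N) * (if H > b N then H else 0)) =
      16 * H * (\<Sum>N<K. if H > b N then r1 ^ N else 0) + 128 * H\<^sup>2 * (\<Sum>N<K. if \<not> H > b N then r2 ^ N else 0)"
    unfolding b1 b2 sum_distrib_left sum.distrib[symmetric] by (intro sum.cong) auto
  also have "\<dots> \<le> 16 * H * (H powr (p - 1) / (1 - 1 / r1)) + 128 * H\<^sup>2 * (H powr (p - 2) / (1 - r2))"
    using S1 S2 \<open>H > 0\<close> by (intro add_mono mult_left_mono) auto
  also have "\<dots> = block_const p * H powr p"
  proof -
    have "H * H powr (p - 1) = H powr p" "H\<^sup>2 * H powr (p - 2) = H powr p"
      using \<open>H > 0\<close> powr_add[of H 1 "p - 1"] powr_add[of H 2 "p - 2"] by simp_all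
    then show ?thesis
      by (simp add: block_const_def r1_def[symmetric] r2_def[symmetric] distrib_right flip: times_divide_eq_right mult.assoc)
         (simp add: mult.assoc)
  qed
  finally show ?thesis .
qed

section \<open>Elementary reductions for moments, suprema and limits\<close>

lemma integrable_of_powr:
  fixes f :: "'a \<Rightarrow> real"
  assumes "finite_measure N" "1 \<le> p" "integrable N (\<lambda>x. \<bar>f x\<bar> powr p)" "f \<in> borel_measurable N"
  shows "integrable N f"
proof (rule Bochner_Integration.integrable_bound)
  show "integrable N (\<lambda>x. 1 + \<bar>f x\<bar> powr p)"
    using assms by (intro Bochner_Integration.integrable_add finite_measure.integrable_const)
  have "\<bar>y\<bar> \<le> 1 + \<bar>y\<bar> powr p" for y :: real
  proof (cases "\<bar>y\<bar> \<le> 1")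
    case False
    then have "\<bar>y\<bar> powr 1 \<le> \<bar>y\<bar> powr p" using assms by (intro powr_mono) auto
    then show ?thesis using False by simp
  qed (simp add: add_increasing2)
  then show "AE x in N. norm (f x) \<le> norm (1 + \<bar>f x\<bar> powr p)"
    by (intro AE_I2) simp
qed (use assms in auto)

text \<open>A supremum exceeds \<open>t\<close> strictly exactly when one of its members does; this
  fails for the non-strict inequality. The event becomes a countable union, free of extended
  reals.\<close>

lemma U_max_gt_iff:
  assumes "p > 0"
  shows "U_max p h \<epsilon> \<omega> > ereal t \<longleftrightarrow> (\<exists>n\<ge>1. \<bar>U_stat h \<epsilon> n \<omega>\<bar> > t * real n powr (2 / p))"
proof -
  have "\<bar>U_stat h \<epsilon> n \<omega>\<bar> / real n powr (2 / p) > t \<longleftrightarrow> \<bar>U_stat h \<epsilon> n \<omega>\<bar> > t * real n powr (2 / p)"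
    if "n \<ge> 1" for n
    using that by (simp add: field_simps)
  then show ?thesis unfolding U_max_def by (auto simp: less_SUP_iff)
qed

text \<open>Only countably many levels are tested, so that almost sure statements for the single
  levels can be combined.\<close>

lemma tendsto_zero_if_eventually_le:
  fixes f :: "nat \<Rightarrow> real"
  assumes "\<And>n. 0 \<le> f n" "\<And>j. eventually (\<lambda>n. f n \<le> 1 / real (Suc j)) sequentially"
  shows "f \<longlonglongrightarrow> 0"
proof (rule tendstoI)
  fix e :: real assume "e > 0"
  then obtain j where j: "1 / real (Suc j) < e" using nat_approx_posE by metis
  from assms(2)[of j] show "eventually (\<lambda>n. dist (f n) 0 < e) sequentially"
    by eventually_elim (use assms(1) j in \<open>auto simp: dist_real_def abs_of_nonneg intro: le_less_trans\<close>)
qed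

section \<open>Index pairs and symmetries of the U-statistic\<close>

definition index_pairs :: "nat \<Rightarrow> (int \<times> int) set" where
  "index_pairs n = {(i, j). 1 \<le> i \<and> i < j \<and> j \<le> int n}"

lemma index_pairs_subset: "index_pairs n \<subseteq> {1..int n} \<times> {1..int n}"
  by (auto simp: index_pairs_def)

lemma finite_index_pairs [simp]: "finite (index_pairs n)"
  using index_pairs_subset by (rule finite_subset) auto

lemma index_pairs_mono: "m \<le> n \<Longrightarrow> index_pairs m \<subseteq> index_pairs n"
  by (auto simp: index_pairs_def)

lemma index_pairs_Int_swap: "index_pairs n \<inter> prod.swap ` index_pairs n = {}"
  by (auto simp: index_pairs_def)

lemma card_index_pairs_le: "2 * real (card (index_pairs n)) \<le> (real n)\<^sup>2"
proof -
  have "2 * card (index_pairs n) = card (index_pairs n) + card (prod.swap ` index_pairs n)"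
    by (simp add: card_image)
  also have "\<dots> = card (index_pairs n \<union> prod.swap ` index_pairs n)"
    by (simp add: card_Un_disjoint index_pairs_Int_swap)
  also have "\<dots> \<le> card ({1..int n} \<times> {1..int n})"
    by (intro card_mono) (auto simp: index_pairs_def)
  finally have "2 * card (index_pairs n) \<le> n * n"
    by simp
  then have "real (2 * card (index_pairs n)) \<le> real (n * n)"
    by (simp only: of_nat_le_iff)
  then show ?thesis by (simp add: power2_eq_square)
qed

abbreviation U_coord :: "('a \<Rightarrow> 'a \<Rightarrow> real) \<Rightarrow> nat \<Rightarrow> (int \<Rightarrow> 'a) \<Rightarrow> real" where
  "U_coord k \<equiv> U_stat k (\<lambda>i \<omega>. \<omega> i)"

lemma U_coord_eq: "U_coord k n \<omega> = (\<Sum>z\<in>index_pairs n. k (\<omega> (fst z)) (\<omega> (snd z)))"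
  by (simp add: U_stat_def index_pairs_def case_prod_unfold)

lemma U_coord_diff: "U_coord (\<lambda>x y. k x y - l x y) n \<omega> = U_coord k n \<omega> - U_coord l n \<omega>"
  by (simp add: U_coord_eq sum_subtractf)

text \<open>Adaptedness in functional form; it takes the place of measurability with respect to a
  filtration.\<close>

lemma U_coord_fun_upd: "int n < j \<Longrightarrow> U_coord k n (fun_upd \<omega> j y) = U_coord k n \<omega>"
  unfolding U_coord_eq by (intro sum.cong) (auto simp: index_pairs_def)

text \<open>Twice the statistic is the sum over all off-diagonal pairs, a set that the transposition
  permutes, whereas the ordered pairs are not preserved. Symmetry is asked at the values of
  \<open>\<omega>\<close>, since kernels are later symmetric on the space of the measure
  only.\<close>

lemma U_coord_transpose:
  assumes sym: "\<And>i j. k (\<omega> i) (\<omega> j) = k (\<omega> j) (\<omega> i)"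
    and ab: "a \<in> {1..int n}" "b \<in> {1..int n}"
  shows "U_coord k n (\<omega> \<circ> Transposition.transpose a b) = U_coord k n \<omega>"
proof -
  define D where "D = {z \<in> {1..int n} \<times> {1..int n}. fst z \<noteq> snd z}"
  have two: "2 * U_coord k n \<omega>' = (\<Sum>z\<in>D. k (\<omega>' (fst z)) (\<omega>' (snd z)))"
    if "\<And>i j. k (\<omega>' i) (\<omega>' j) = k (\<omega>' j) (\<omega>' i)" for \<omega>'
  proof -
    have "D = index_pairs n \<union> prod.swap ` index_pairs n"
      by (force simp: D_def index_pairs_def)
    then have "(\<Sum>z\<in>D. k (\<omega>' (fst z)) (\<omega>' (snd z))) =
        (\<Sum>z\<in>index_pairs n. k (\<omega>' (fst z)) (\<omega>' (snd z))) +
        (\<Sum>z\<in>prod.swap ` index_pairs n. k (\<omega>' (fst z)) (\<omega>' (snd z)))"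
      by (simp only:) (rule sum.union_disjoint; simp add: index_pairs_Int_swap)
    also have "(\<Sum>z\<in>prod.swap ` index_pairs n. k (\<omega>' (fst z)) (\<omega>' (snd z))) =
        (\<Sum>z\<in>index_pairs n. k (\<omega>' (fst z)) (\<omega>' (snd z)))"
      by (subst sum.reindex) (auto simp: that)
    finally show ?thesis by (simp add: U_coord_eq)
  qed
  let ?t = "Transposition.transpose a b"
  have mem: "?t i \<in> {1..int n} \<longleftrightarrow> i \<in> {1..int n}" for i
    using ab by (auto simp: Transposition.transpose_def)
  have "bij_betw (map_prod ?t ?t) D D"
  proof (rule bij_betw_byWitness[where f' = "map_prod ?t ?t"])
    show "map_prod ?t ?t ` D \<subseteq> D" "map_prod ?t ?t ` D \<subseteq> D"
      unfolding D_def using mem by (auto dest: injD[OF inj_transpose])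
  qed auto
  then have "(\<Sum>z\<in>D. k (\<omega> (fst (map_prod ?t ?t z))) (\<omega> (snd (map_prod ?t ?t z)))) =
      (\<Sum>z\<in>D. k (\<omega> (fst z)) (\<omega> (snd z)))"
    by (rule sum.reindex_bij_betw)
  then have "2 * U_coord k n (\<omega> \<circ> ?t) = 2 * U_coord k n \<omega>"
    by (subst (1 2) two) (auto simp: sym)
  then show ?thesis by simp
qed

section \<open>Products of a single probability space\<close>

context prob_space
begin

abbreviation iid :: "(int \<Rightarrow> 'a) measure" where
  "iid \<equiv> Pi\<^sub>M UNIV (\<lambda>_. M)"

lemma prob_space_iid: "prob_space iid"
  by (intro prob_space_PiM prob_space_axioms)

interpretation iid: prob_space iid
  by (rule prob_space_iid)

interpretation MM: pair_prob_space M M ..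

lemma measurable_fun_upd_iid [measurable]:
  "(\<lambda>z. (snd z)(j := fst z)) \<in> M \<Otimes>\<^sub>M iid \<rightarrow>\<^sub>M iid"
  by (rule measurable_fun_upd[of UNIV UNIV]) auto

text \<open>The form in which independence is used: one coordinate may be resampled by a fresh draw
  from \<open>M\<close>, after which Fubini integrates over that draw alone.\<close>

lemma distr_fun_upd_iid:
  "distr (M \<Otimes>\<^sub>M iid) iid (\<lambda>z. (snd z)(j := fst z)) = iid"
  using distr_pair_PiM_eq_PiM[of UNIV "\<lambda>_. M" j]
  by (simp add: prob_space_axioms case_prod_unfold)

lemma distr_transpose_iid:
  "distr iid iid (\<lambda>\<omega>. \<omega> \<circ> Transposition.transpose a b) = iid"
  using distr_PiM_reindex[of UNIV "\<lambda>_. M" "Transposition.transpose a b" UNIV]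
  by (simp add: prob_space_axioms comp_def restrict_def)

lemma measurable_transpose_iid [measurable]:
  "(\<lambda>\<omega>. \<omega> \<circ> Transposition.transpose a b) \<in> iid \<rightarrow>\<^sub>M iid"
  unfolding comp_def by (rule measurable_PiM_single') (auto simp: space_PiM)

text \<open>After coordinate \<open>i\<close> is resampled, the pair consists of the fresh draw and
  an untouched coordinate, so its law is visibly a product.\<close>

lemma distr_coordinate_pair:
  assumes "i \<noteq> j"
  shows "distr iid (M \<Otimes>\<^sub>M M) (\<lambda>\<omega>. (\<omega> i, \<omega> j)) = M \<Otimes>\<^sub>M M"
proof -
  have "distr iid (M \<Otimes>\<^sub>M M) (\<lambda>\<omega>. (\<omega> i, \<omega> j)) =
      distr (distr (M \<Otimes>\<^sub>M iid) iid (\<lambda>z. (snd z)(i := fst z))) (M \<Otimes>\<^sub>M M) (\<lambda>\<omega>. (\<omega> i, \<omega> j))"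
    by (simp only: distr_fun_upd_iid)
  also have "\<dots> = distr (M \<Otimes>\<^sub>M iid) (M \<Otimes>\<^sub>M M) (\<lambda>(x, \<omega>). (id x, \<omega> j))"
    using assms by (subst distr_distr) (auto simp: comp_def case_prod_unfold)
  also have "\<dots> = distr M M id \<Otimes>\<^sub>M distr iid M (\<lambda>\<omega>. \<omega> j)"
    by (rule pair_measure_distr[symmetric])
       (auto intro!: prob_space_imp_sigma_finite iid.prob_space_distr)
  also have "\<dots> = M \<Otimes>\<^sub>M M"
    by (subst distr_PiM_component) (auto simp: prob_space_axioms id_def distr_id2)
  finally show ?thesis .
qed

lemma measurable_coordinate_pair:
  assumes "case_prod k \<in> borel_measurable (M \<Otimes>\<^sub>M M)"
  shows "(\<lambda>\<omega>. k (\<omega> i) (\<omega> j)) \<in> borel_measurable iid"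
  using measurable_compose[OF _ assms, of "\<lambda>\<omega>. (\<omega> i, \<omega> j)" iid] by simp

lemma integral_coordinate_pair:
  fixes k :: "'a \<Rightarrow> 'a \<Rightarrow> real"
  assumes "i \<noteq> j" and k: "case_prod k \<in> borel_measurable (M \<Otimes>\<^sub>M M)"
  shows "(\<integral>\<omega>. k (\<omega> i) (\<omega> j) \<partial>iid) = (\<integral>z. k (fst z) (snd z) \<partial>(M \<Otimes>\<^sub>M M))"
proof -
  have "(\<integral>z. case_prod k z \<partial>(M \<Otimes>\<^sub>M M)) =
      (\<integral>z. case_prod k z \<partial>(distr iid (M \<Otimes>\<^sub>M M) (\<lambda>\<omega>. (\<omega> i, \<omega> j))))"
    by (simp only: distr_coordinate_pair[OF \<open>i \<noteq> j\<close>])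
  also have "\<dots> = (\<integral>\<omega>. k (\<omega> i) (\<omega> j) \<partial>iid)"
    using k by (subst integral_distr) auto
  finally show ?thesis by (simp add: case_prod_unfold)
qed

lemma integrable_coordinate_pair_iff:
  fixes k :: "'a \<Rightarrow> 'a \<Rightarrow> real"
  assumes "i \<noteq> j" and k: "case_prod k \<in> borel_measurable (M \<Otimes>\<^sub>M M)"
  shows "integrable iid (\<lambda>\<omega>. k (\<omega> i) (\<omega> j)) \<longleftrightarrow> integrable (M \<Otimes>\<^sub>M M) (\<lambda>z. k (fst z) (snd z))"
proof -
  have "integrable (M \<Otimes>\<^sub>M M) (case_prod k) \<longleftrightarrow>
      integrable (distr iid (M \<Otimes>\<^sub>M M) (\<lambda>\<omega>. (\<omega> i, \<omega> j))) (case_prod k)"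
    by (simp only: distr_coordinate_pair[OF \<open>i \<noteq> j\<close>])
  also have "\<dots> \<longleftrightarrow> integrable iid (\<lambda>\<omega>. k (\<omega> i) (\<omega> j))"
    using k by (subst integrable_distr_eq) auto
  finally show ?thesis by (simp add: case_prod_unfold)
qed

text \<open>Integrability of the sections is demanded on its own, since the Bochner integral of a
  non-integrable function is 0 by convention. By symmetry the integral over the other argument
  vanishes as well.\<close>

definition degenerate :: "('a \<Rightarrow> 'a \<Rightarrow> real) \<Rightarrow> bool" where
  "degenerate k \<longleftrightarrow> case_prod k \<in> borel_measurable (M \<Otimes>\<^sub>M M) \<and>
     (\<forall>x\<in>space M. \<forall>y\<in>space M. k x y = k y x) \<and>
     (\<forall>x\<in>space M. integrable M (\<lambda>y. k y x) \<and> (\<integral>y. k y x \<partial>M) = 0)"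

text \<open>The martingale difference property without conditional expectations: \<open>F\<close>
  ignores coordinate \<open>j\<close>, so once that coordinate is resampled, the inner integral over
  the fresh draw is that of a section of \<open>k\<close>, which is 0.\<close>

lemma integral_degenerate_mult_eq_0:
  assumes k: "degenerate k" and "i \<noteq> j"
    and F: "F \<in> borel_measurable iid" "\<And>\<omega> y. F (fun_upd \<omega> j y) = F \<omega>"
    and int: "integrable iid (\<lambda>\<omega>. F \<omega> * k (\<omega> i) (\<omega> j))"
  shows "(\<integral>\<omega>. F \<omega> * k (\<omega> i) (\<omega> j) \<partial>iid) = (0::real)"
proof -
  interpret MI: pair_prob_space M iid ..
  have [measurable]: "case_prod k \<in> borel_measurable (M \<Otimes>\<^sub>M M)"
    using k by (simp add: degenerate_def)
  have meas: "(\<lambda>\<omega>. F \<omega> * k (\<omega> i) (\<omega> j)) \<in> borel_measurable iid"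
    using int by simp
  have *: "(\<lambda>z. F (snd z) * k (snd z i) (fst z)) =
       (\<lambda>z. (\<lambda>\<omega>. F \<omega> * k (\<omega> i) (\<omega> j)) ((snd z)(j := fst z)))"
    using F(2) \<open>i \<noteq> j\<close> by auto
  have int': "integrable (M \<Otimes>\<^sub>M iid) (\<lambda>z. F (snd z) * k (snd z i) (fst z))"
    unfolding * using int meas
    by (subst integrable_distr_eq[symmetric, where N=iid]) (auto simp only: distr_fun_upd_iid measurable_fun_upd_iid)
  have "(\<integral>\<omega>. F \<omega> * k (\<omega> i) (\<omega> j) \<partial>iid) =
      (\<integral>\<omega>. F \<omega> * k (\<omega> i) (\<omega> j) \<partial>(distr (M \<Otimes>\<^sub>M iid) iid (\<lambda>z. (snd z)(j := fst z))))"
    by (simp only: distr_fun_upd_iid)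
  also have "\<dots> = (\<integral>z. F (snd z) * k (snd z i) (fst z) \<partial>(M \<Otimes>\<^sub>M iid))"
    unfolding * by (subst integral_distr) (use meas in auto)
  also have "\<dots> = (\<integral>\<omega>. (\<integral>y. F \<omega> * k (\<omega> i) y \<partial>M) \<partial>iid)"
    using MI.integral_snd[of "\<lambda>y \<omega>. F \<omega> * k (\<omega> i) y"] int' by (simp add: case_prod_unfold)
  also have "\<dots> = (\<integral>\<omega>. 0 \<partial>iid)"
  proof (rule Bochner_Integration.integral_cong[OF refl])
    fix \<omega> assume "\<omega> \<in> space iid"
    then have "\<omega> i \<in> space M" by (auto simp: space_PiM)
    \<comment> \<open>The fresh draw sits in the second argument, whereas \<open>degenerate\<close>
      speaks of the first; symmetry exchanges them.\<close>
    then have "(\<integral>y. k (\<omega> i) y \<partial>M) = (\<integral>y. k y (\<omega> i) \<partial>M)"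
      using k by (intro Bochner_Integration.integral_cong refl) (auto simp: degenerate_def)
    then show "(\<integral>y. F \<omega> * k (\<omega> i) y \<partial>M) = 0"
      using k \<open>\<omega> i \<in> space M\<close> by (auto simp: degenerate_def)
  qed
  finally show ?thesis by simp
qed

section \<open>Maximal inequalities\<close>

lemma measurable_U_coord:
  assumes "case_prod k \<in> borel_measurable (M \<Otimes>\<^sub>M M)"
  shows "U_coord k n \<in> borel_measurable iid"
  unfolding U_coord_eq[abs_def]
  by (intro borel_measurable_sum measurable_coordinate_pair assms)

lemma abs_U_coord_le:
  assumes "\<And>x y. x \<in> space M \<Longrightarrow> y \<in> space M \<Longrightarrow> \<bar>k x y\<bar> \<le> B" "\<omega> \<in> space iid"
  shows "\<bar>U_coord k n \<omega>\<bar> \<le> real (card (index_pairs n)) * B"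
proof -
  have "\<omega> i \<in> space M" for i using assms(2) by (auto simp: space_PiM)
  then show ?thesis
    unfolding U_coord_eq using assms(1)
    by (intro order_trans[OF sum_abs] sum_bounded_above) auto
qed

text \<open>The index \<open>j\<close> occurs in one factor only, so the other factor serves as the
  function \<open>F\<close> that ignores coordinate \<open>j\<close>. Boundedness of
  \<open>k\<close> makes the product integrable.\<close>

lemma integral_degenerate_mult_distinct:
  assumes k: "degenerate k" and B: "\<And>x y. x \<in> space M \<Longrightarrow> y \<in> space M \<Longrightarrow> \<bar>k x y\<bar> \<le> B"
    and "i \<noteq> j" "i' \<noteq> j'" "j \<noteq> i'" "j \<noteq> j'"
  shows "(\<integral>\<omega>. k (\<omega> i) (\<omega> j) * k (\<omega> i') (\<omega> j') \<partial>iid) = 0"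
proof -
  have meas: "case_prod k \<in> borel_measurable (M \<Otimes>\<^sub>M M)"
    using k by (simp add: degenerate_def)
  note [measurable] = measurable_coordinate_pair[OF meas]
  have "integrable iid (\<lambda>\<omega>. k (\<omega> i') (\<omega> j') * k (\<omega> i) (\<omega> j))"
  proof (rule iid.integrable_const_bound[where B="B * B"])
    show "AE \<omega> in iid. norm (k (\<omega> i') (\<omega> j') * k (\<omega> i) (\<omega> j)) \<le> B * B"
    proof (rule AE_I2)
      fix \<omega> assume "\<omega> \<in> space iid"
      then have "\<omega> l \<in> space M" for l by (auto simp: space_PiM)
      then have "\<bar>k (\<omega> i') (\<omega> j')\<bar> \<le> B" "\<bar>k (\<omega> i) (\<omega> j)\<bar> \<le> B" using B by auto
      then show "norm (k (\<omega> i') (\<omega> j') * k (\<omega> i) (\<omega> j)) \<le> B * B"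
        by (simp add: abs_mult mult_mono')
    qed
  qed measurable
  then have "(\<integral>\<omega>. k (\<omega> i') (\<omega> j') * k (\<omega> i) (\<omega> j) \<partial>iid) = 0"
    using assms by (intro integral_degenerate_mult_eq_0) auto
  then show ?thesis by (simp add: mult.commute)
qed

text \<open>Distinct pairs are orthogonal, so the square expands to its diagonal, which has at most
  n^2 / 2 terms. This is the gain from degeneracy.\<close>

lemma second_moment_U_coord:
  assumes k: "degenerate k" and B: "\<And>x y. x \<in> space M \<Longrightarrow> y \<in> space M \<Longrightarrow> \<bar>k x y\<bar> \<le> B"
  shows "(\<integral>\<omega>. (U_coord k n \<omega>)\<^sup>2 \<partial>iid) \<le> (real n)\<^sup>2 / 2 * (\<integral>z. (k (fst z) (snd z))\<^sup>2 \<partial>(M \<Otimes>\<^sub>M M))"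
proof -
  have meas: "case_prod k \<in> borel_measurable (M \<Otimes>\<^sub>M M)"
    using k by (simp add: degenerate_def)
  note [measurable] = measurable_coordinate_pair[OF meas]
  define X where "X z \<omega> = k (\<omega> (fst z)) (\<omega> (snd z))" for z :: "int \<times> int" and \<omega>
  have X[measurable]: "X z \<in> borel_measurable iid" for z unfolding X_def by measurable
  have int: "integrable iid (\<lambda>\<omega>. X z \<omega> * X z' \<omega>)" for z z'
  proof (rule iid.integrable_const_bound[where B="B * B"])
    show "AE \<omega> in iid. norm (X z \<omega> * X z' \<omega>) \<le> B * B"
    proof (rule AE_I2)
      fix \<omega> assume "\<omega> \<in> space iid"
      then have "\<omega> l \<in> space M" for l by (auto simp: space_PiM)
      then have "\<bar>X z \<omega>\<bar> \<le> B" "\<bar>X z' \<omega>\<bar> \<le> B" using B by (auto simp: X_def)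
      then show "norm (X z \<omega> * X z' \<omega>) \<le> B * B"
        by (simp add: abs_mult mult_mono')
    qed
  qed measurable
  have zero: "(\<integral>\<omega>. X z \<omega> * X z' \<omega> \<partial>iid) = 0"
    if z: "z \<in> index_pairs n" "z' \<in> index_pairs n" "z \<noteq> z'" for z z'
  proof -
    obtain i j i' j' where [simp]: "z = (i, j)" "z' = (i', j')" by (cases z, cases z') auto
    have ne: "i \<noteq> j" "i' \<noteq> j'" using z by (auto simp: index_pairs_def)
    show ?thesis
    proof (cases "j \<noteq> i' \<and> j \<noteq> j'")
      case True
      then show ?thesis using integral_degenerate_mult_distinct[OF k B] ne by (auto simp: X_def)
    next
      case False
      \<comment> \<open>Two distinct increasing pairs cannot share both indices. So if
        \<open>j\<close> occurs in \<open>z'\<close>, then \<open>i\<close> does not, and symmetry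
        of \<open>k\<close> lets \<open>i\<close> take the role of \<open>j\<close>.\<close>
      then have "i \<noteq> i' \<and> i \<noteq> j'" using z by (auto simp: index_pairs_def)
      then have "(\<integral>\<omega>. k (\<omega> j) (\<omega> i) * k (\<omega> i') (\<omega> j') \<partial>iid) = 0"
        using ne by (intro integral_degenerate_mult_distinct[OF k B]) auto
      moreover have "(\<integral>\<omega>. X z \<omega> * X z' \<omega> \<partial>iid) = (\<integral>\<omega>. k (\<omega> j) (\<omega> i) * k (\<omega> i') (\<omega> j') \<partial>iid)"
        using k by (intro Bochner_Integration.integral_cong)
          (auto simp: X_def degenerate_def space_PiM PiE_iff)
      ultimately show ?thesis by simp
    qed
  qed
  have sq: "case_prod (\<lambda>x y. k x y * k x y) \<in> borel_measurable (M \<Otimes>\<^sub>M M)"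
    using borel_measurable_times[OF meas meas] by (simp add: case_prod_unfold)
  have diag: "(\<integral>\<omega>. X z \<omega> * X z \<omega> \<partial>iid) = (\<integral>z. (k (fst z) (snd z))\<^sup>2 \<partial>(M \<Otimes>\<^sub>M M))"
    if "z \<in> index_pairs n" for z
    unfolding X_def power2_eq_square
    using that by (intro integral_coordinate_pair sq) (auto simp: index_pairs_def)
  have "(\<integral>\<omega>. (U_coord k n \<omega>)\<^sup>2 \<partial>iid) =
      (\<integral>\<omega>. (\<Sum>z\<in>index_pairs n. \<Sum>z'\<in>index_pairs n. X z \<omega> * X z' \<omega>) \<partial>iid)"
    by (simp add: U_coord_eq X_def power2_eq_square sum_product)
  also have "\<dots> = (\<Sum>z\<in>index_pairs n. \<Sum>z'\<in>index_pairs n. (\<integral>\<omega>. X z \<omega> * X z' \<omega> \<partial>iid))"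
    by (subst Bochner_Integration.integral_sum) (auto intro!: int sum.cong Bochner_Integration.integral_sum)
  also have "\<dots> = (\<Sum>z\<in>index_pairs n. \<Sum>z'\<in>index_pairs n.
      if z' = z then (\<integral>z. (k (fst z) (snd z))\<^sup>2 \<partial>(M \<Otimes>\<^sub>M M)) else 0)"
    by (intro sum.cong refl) (simp add: zero diag)
  also have "\<dots> = real (card (index_pairs n)) * (\<integral>z. (k (fst z) (snd z))\<^sup>2 \<partial>(M \<Otimes>\<^sub>M M))"
    by simp
  also have "\<dots> \<le> (real n)\<^sup>2 / 2 * (\<integral>z. (k (fst z) (snd z))\<^sup>2 \<partial>(M \<Otimes>\<^sub>M M))"
    using card_index_pairs_le[of n] by (intro mult_right_mono) auto
  finally show ?thesis .
qed

text \<open>Kolmogorov's argument: \<open>G n\<close> marks \<open>n\<close> as the first time the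
  level is exceeded. It depends on coordinates up to \<open>n\<close> only, so \<open>G n\<close>
  times U_n is orthogonal to the later increment U_m - U_n.\<close>

lemma maximal_inequality_degenerate:
  assumes k: "degenerate k" and B: "\<And>x y. x \<in> space M \<Longrightarrow> y \<in> space M \<Longrightarrow> \<bar>k x y\<bar> \<le> B"
    and "c > 0"
  shows "c\<^sup>2 * measure iid {\<omega> \<in> space iid. \<exists>n\<le>m. \<bar>U_coord k n \<omega>\<bar> > c} \<le>
    (\<integral>\<omega>. (U_coord k m \<omega>)\<^sup>2 \<partial>iid)"
proof -
  have meas: "case_prod k \<in> borel_measurable (M \<Otimes>\<^sub>M M)"
    using k by (simp add: degenerate_def)
  note [measurable] = measurable_coordinate_pair[OF meas] measurable_U_coord[OF meas]
  define G :: "nat \<Rightarrow> (int \<Rightarrow> 'a) \<Rightarrow> real" where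
    "G n \<omega> = (if \<bar>U_coord k n \<omega>\<bar> > c \<and> (\<forall>l\<in>{..<n}. \<bar>U_coord k l \<omega>\<bar> \<le> c) then 1 else 0)" for n \<omega>
  have [measurable]: "G n \<in> borel_measurable iid" for n unfolding G_def by measurable
  have G01: "0 \<le> G n \<omega>" "G n \<omega> \<le> 1" for n \<omega> by (auto simp: G_def)
  let ?A = "{\<omega> \<in> space iid. \<exists>n\<le>m. \<bar>U_coord k n \<omega>\<bar> > c}"
  have A[measurable]: "?A \<in> sets iid"
  proof -
    have "?A = {\<omega> \<in> space iid. \<exists>n\<in>{..m}. \<bar>U_coord k n \<omega>\<bar> > c}" by auto
    then show ?thesis by simp
  qed
  have sumG: "(\<Sum>n\<le>m. G n \<omega>) \<le> 1" for \<omega>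
  proof (cases "\<exists>n\<le>m. G n \<omega> = 1")
    case True
    then obtain n where n: "n \<le> m" "G n \<omega> = 1" by auto
    have "G i \<omega> = 0" if "i \<noteq> n" for i
    proof (cases "i < n")
      case True
      then show ?thesis using n(2) by (force simp: G_def not_less split: if_splits)
    next
      case False
      then have "n \<in> {..<i}" using that by simp
      moreover have "\<not> \<bar>U_coord k n \<omega>\<bar> \<le> c" using n(2) by (simp add: G_def split: if_splits)
      ultimately show ?thesis unfolding G_def by meson
    qed
    then have "(\<Sum>i\<le>m. G i \<omega>) = (\<Sum>i\<in>{n}. G i \<omega>)"
      using n by (intro sum.mono_neutral_right) auto
    then show ?thesis using n by simp
  next
    case False
    then have "G n \<omega> = 0" if "n \<le> m" for n using that by (auto simp: G_def split: if_splits)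
    then show ?thesis by simp
  qed
  have ind: "indicator ?A \<omega> \<le> (\<Sum>n\<le>m. G n \<omega>)" for \<omega>
  proof (cases "\<omega> \<in> ?A")
    case True
    then obtain n0 where "n0 \<le> m" "\<bar>U_coord k n0 \<omega>\<bar> > c" by auto
    define n where "n = (LEAST n. \<bar>U_coord k n \<omega>\<bar> > c)"
    have 1: "\<bar>U_coord k n \<omega>\<bar> > c" "n \<le> n0"
      unfolding n_def using \<open>\<bar>U_coord k n0 \<omega>\<bar> > c\<close> by (rule LeastI, rule Least_le)
    have "\<not> \<bar>U_coord k l \<omega>\<bar> > c" if "l < n" for l
      using that unfolding n_def by (rule not_less_Least)
    with 1 have "G n \<omega> = 1" by (auto simp: G_def not_less)
    moreover have "G n \<omega> \<le> (\<Sum>n\<le>m. G n \<omega>)"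
      using 1 \<open>n0 \<le> m\<close> by (intro member_le_sum) (auto simp: G01)
    ultimately show ?thesis using True by simp
  qed (simp add: sum_nonneg G01)
  define C where "C n = real (card (index_pairs n)) * B" for n
  have C: "\<bar>U_coord k n \<omega>\<bar> \<le> C n" if "\<omega> \<in> space iid" for n \<omega>
    unfolding C_def by (rule abs_U_coord_le[OF B that])
  have int: "integrable iid (\<lambda>\<omega>. G n \<omega> * (U_coord k a \<omega> * U_coord k b \<omega>))" for n a b
  proof (rule iid.integrable_const_bound[where B="1 * (C a * C b)"])
    show "AE \<omega> in iid. norm (G n \<omega> * (U_coord k a \<omega> * U_coord k b \<omega>)) \<le> 1 * (C a * C b)"
      unfolding real_norm_def abs_mult using C G01 by (intro AE_I2 mult_mono') auto
  qed measurable
  have intG: "integrable iid (G n)" for n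
    by (rule iid.integrable_const_bound[where B=1]) (auto simp: G01)
  have intU: "integrable iid (\<lambda>\<omega>. (U_coord k m \<omega>)\<^sup>2)"
  proof (rule iid.integrable_const_bound[where B="C m * C m"])
    show "AE \<omega> in iid. norm ((U_coord k m \<omega>)\<^sup>2) \<le> C m * C m"
      unfolding real_norm_def abs_mult power2_eq_square using C by (intro AE_I2 mult_mono') auto
  qed measurable
  have step: "c\<^sup>2 * (\<integral>\<omega>. G n \<omega> \<partial>iid) \<le> (\<integral>\<omega>. G n \<omega> * (U_coord k m \<omega> * U_coord k m \<omega>) \<partial>iid)"
    if "n \<le> m" for n
  proof -
    \<comment> \<open>Every pair that enters after time \<open>n\<close> has its larger index beyond
      \<open>n\<close>, a coordinate that neither \<open>G n\<close> nor \<open>U_coord k n\<close>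
      sees.\<close>
    have zero: "(\<integral>\<omega>. (G n \<omega> * U_coord k n \<omega>) * k (\<omega> (fst z)) (\<omega> (snd z)) \<partial>iid) = 0"
      and int0: "integrable iid (\<lambda>\<omega>. (G n \<omega> * U_coord k n \<omega>) * k (\<omega> (fst z)) (\<omega> (snd z)))"
      if z: "z \<in> index_pairs m - index_pairs n" for z
    proof -
      have sz: "int n < snd z" "fst z \<noteq> snd z" using z by (auto simp: index_pairs_def)
      show *: "integrable iid (\<lambda>\<omega>. (G n \<omega> * U_coord k n \<omega>) * k (\<omega> (fst z)) (\<omega> (snd z)))"
      proof (rule iid.integrable_const_bound[where B="(1 * C n) * B"])
        show "AE \<omega> in iid. norm ((G n \<omega> * U_coord k n \<omega>) * k (\<omega> (fst z)) (\<omega> (snd z))) \<le> (1 * C n) * B"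
          unfolding real_norm_def abs_mult using C G01 B
          by (intro AE_I2 mult_mono') (auto simp: space_PiM PiE_iff)
      qed measurable
      show "(\<integral>\<omega>. (G n \<omega> * U_coord k n \<omega>) * k (\<omega> (fst z)) (\<omega> (snd z)) \<partial>iid) = 0"
        by (rule integral_degenerate_mult_eq_0[OF k sz(2) _ _ *])
           (use sz in \<open>auto simp: G_def U_coord_fun_upd\<close>)
    qed
    have U_diff: "U_coord k m \<omega> - U_coord k n \<omega> =
        (\<Sum>z\<in>index_pairs m - index_pairs n. k (\<omega> (fst z)) (\<omega> (snd z)))" for \<omega>
      unfolding U_coord_eq using index_pairs_mono[OF \<open>n \<le> m\<close>] by (simp add: sum_diff)
    have "(\<integral>\<omega>. G n \<omega> * U_coord k n \<omega> * (U_coord k m \<omega> - U_coord k n \<omega>) \<partial>iid) = 0"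
      unfolding U_diff sum_distrib_left
      by (subst Bochner_Integration.integral_sum) (auto intro!: int0 simp: zero)
    then have cross: "(\<integral>\<omega>. G n \<omega> * (U_coord k n \<omega> * U_coord k m \<omega>) \<partial>iid) =
        (\<integral>\<omega>. G n \<omega> * (U_coord k n \<omega> * U_coord k n \<omega>) \<partial>iid)"
      using int[of n n m] int[of n n n] by (simp add: algebra_simps)
    have "c\<^sup>2 * (\<integral>\<omega>. G n \<omega> \<partial>iid) = (\<integral>\<omega>. c\<^sup>2 * G n \<omega> \<partial>iid)" by simp
    also have "\<dots> \<le> (\<integral>\<omega>. G n \<omega> * (U_coord k n \<omega> * U_coord k n \<omega>) \<partial>iid)"
    proof (rule integral_mono)
      fix \<omega>
      have "c * c \<le> \<bar>U_coord k n \<omega>\<bar> * \<bar>U_coord k n \<omega>\<bar>" if "\<bar>U_coord k n \<omega>\<bar> > c"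
        using that \<open>c > 0\<close> by (intro mult_mono) auto
      then show "c\<^sup>2 * G n \<omega> \<le> G n \<omega> * (U_coord k n \<omega> * U_coord k n \<omega>)"
        by (auto simp: G_def power2_eq_square)
    qed (use intG int in auto)
    \<comment> \<open>By \<open>cross\<close>, the integral of G_n U_n^2 equals that of G_n U_n U_m.
      In this form the integrand is at most G_n U_m^2 pointwise, because (U_m - U_n)^2 is
      nonnegative.\<close>
    also have "\<dots> = (\<integral>\<omega>. 2 * (G n \<omega> * (U_coord k n \<omega> * U_coord k m \<omega>)) -
        G n \<omega> * (U_coord k n \<omega> * U_coord k n \<omega>) \<partial>iid)"
      using int[of n n m] int[of n n n] cross by simp
    also have "\<dots> \<le> (\<integral>\<omega>. G n \<omega> * (U_coord k m \<omega> * U_coord k m \<omega>) \<partial>iid)"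
    proof (rule integral_mono)
      fix \<omega>
      have "0 \<le> (U_coord k m \<omega> - U_coord k n \<omega>)\<^sup>2" by simp
      then have "2 * (U_coord k n \<omega> * U_coord k m \<omega>) - U_coord k n \<omega> * U_coord k n \<omega> \<le>
          U_coord k m \<omega> * U_coord k m \<omega>"
        by (simp add: power2_eq_square algebra_simps)
      from mult_left_mono[OF this G01(1)]
      show "2 * (G n \<omega> * (U_coord k n \<omega> * U_coord k m \<omega>)) - G n \<omega> * (U_coord k n \<omega> * U_coord k n \<omega>)
          \<le> G n \<omega> * (U_coord k m \<omega> * U_coord k m \<omega>)"
        by (simp add: algebra_simps)
    qed (use int in auto)
    finally show ?thesis .
  qed
  have "c\<^sup>2 * measure iid ?A = c\<^sup>2 * (\<integral>\<omega>. indicator ?A \<omega> \<partial>iid)"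
    by simp
  also have "\<dots> \<le> c\<^sup>2 * (\<integral>\<omega>. (\<Sum>n\<le>m. G n \<omega>) \<partial>iid)"
    using ind intG by (intro mult_left_mono integral_mono) (auto simp: iid.emeasure_eq_measure)
  also have "\<dots> = (\<Sum>n\<le>m. c\<^sup>2 * (\<integral>\<omega>. G n \<omega> \<partial>iid))"
    using intG by (simp add: sum_distrib_left)
  also have "\<dots> \<le> (\<Sum>n\<le>m. (\<integral>\<omega>. G n \<omega> * (U_coord k m \<omega> * U_coord k m \<omega>) \<partial>iid))"
    by (intro sum_mono step) auto
  also have "\<dots> = (\<integral>\<omega>. (\<Sum>n\<le>m. G n \<omega>) * (U_coord k m \<omega>)\<^sup>2 \<partial>iid)"
    using int by (simp add: sum_distrib_right power2_eq_square)
  also have "\<dots> \<le> (\<integral>\<omega>. (U_coord k m \<omega>)\<^sup>2 \<partial>iid)"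
  proof (rule integral_mono[OF _ intU])
    show "integrable iid (\<lambda>\<omega>. (\<Sum>n\<le>m. G n \<omega>) * (U_coord k m \<omega>)\<^sup>2)"
      using int by (simp add: sum_distrib_right power2_eq_square)
    show "(\<Sum>n\<le>m. G n \<omega>) * (U_coord k m \<omega>)\<^sup>2 \<le> (U_coord k m \<omega>)\<^sup>2" for \<omega>
      using mult_right_mono[OF sumG, of "(U_coord k m \<omega>)\<^sup>2"] by simp
  qed
  finally show ?thesis .
qed

section \<open>Exchangeability and the maximal inequality with normalisation n^2\<close>

lemma integral_transpose_iid:
  fixes f :: "(int \<Rightarrow> 'a) \<Rightarrow> real"
  assumes "f \<in> borel_measurable iid"
  shows "(\<integral>\<omega>. f (\<omega> \<circ> Transposition.transpose a b) \<partial>iid) = (\<integral>\<omega>. f \<omega> \<partial>iid)"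
proof -
  have "(\<integral>\<omega>. f \<omega> \<partial>iid) = (\<integral>\<omega>. f \<omega> \<partial>distr iid iid (\<lambda>\<omega>. \<omega> \<circ> Transposition.transpose a b))"
    by (simp only: distr_transpose_iid)
  also have "\<dots> = (\<integral>\<omega>. f (\<omega> \<circ> Transposition.transpose a b) \<partial>iid)"
    using assms by (intro integral_distr) measurable
  finally show ?thesis ..
qed

text \<open>
  This replaces the maximal inequality for the reversed martingale \<open>U\<^sub>n / (n choose 2)\<close>: the event
  that \<open>n\<close> is the last time at which the level is exceeded is invariant under permutations of
  the first \<open>n\<close> coordinates, so on it every \<open>\<bar>h (\<epsilon>\<^sub>i, \<epsilon>\<^sub>j)\<bar>\<close> with \<open>i < j \<le> n\<close> has the same integral.
\<close>

lemma maximal_inequality_symmetric: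
  assumes meas: "case_prod k \<in> borel_measurable (M \<Otimes>\<^sub>M M)"
    and sym: "\<And>x y. x \<in> space M \<Longrightarrow> y \<in> space M \<Longrightarrow> k x y = k y x"
    and intk: "integrable (M \<Otimes>\<^sub>M M) (case_prod k)"
    and "x > 0"
  shows "x * measure iid {\<omega> \<in> space iid. \<exists>n\<in>{1..N}. \<bar>U_coord k n \<omega>\<bar> > x * (real n)\<^sup>2} \<le>
    (\<integral>z. \<bar>k (fst z) (snd z)\<bar> \<partial>(M \<Otimes>\<^sub>M M))"
proof -
  note [measurable] = measurable_coordinate_pair[OF meas] measurable_U_coord[OF meas]
  have measa: "case_prod (\<lambda>x y. \<bar>k x y\<bar>) \<in> borel_measurable (M \<Otimes>\<^sub>M M)"
    using borel_measurable_abs[OF meas] by (simp add: case_prod_unfold)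
  define L where "L n \<omega> \<longleftrightarrow> \<bar>U_coord k n \<omega>\<bar> > x * (real n)\<^sup>2" for n and \<omega> :: "int \<Rightarrow> 'a"
  have [measurable]: "Measurable.pred iid (L n)" for n unfolding L_def by measurable
  define G :: "nat \<Rightarrow> (int \<Rightarrow> 'a) \<Rightarrow> real" where
    "G n \<omega> = (if L n \<omega> \<and> (\<forall>l\<in>{n<..N}. \<not> L l \<omega>) then 1 else 0)" for n \<omega>
  have [measurable]: "G n \<in> borel_measurable iid" for n unfolding G_def by measurable
  have G01: "0 \<le> G n \<omega>" "G n \<omega> \<le> 1" for n \<omega> by (auto simp: G_def)
  let ?A = "{\<omega> \<in> space iid. \<exists>n\<in>{1..N}. L n \<omega>}"
  have A[measurable]: "?A \<in> sets iid" by measurable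
  have sumG: "(\<Sum>n\<in>{1..N}. G n \<omega>) \<le> 1" for \<omega>
  proof (cases "\<exists>n\<in>{1..N}. G n \<omega> = 1")
    case True
    then obtain n where n: "n \<in> {1..N}" "G n \<omega> = 1" by auto
    have "G i \<omega> = 0" if "i \<noteq> n" "i \<in> {1..N}" for i
    proof (rule ccontr)
      assume "G i \<omega> \<noteq> 0"
      then have "L i \<omega>" "\<forall>l\<in>{i<..N}. \<not> L l \<omega>" by (auto simp: G_def split: if_splits)
      moreover have "L n \<omega>" "\<forall>l\<in>{n<..N}. \<not> L l \<omega>" using n by (auto simp: G_def split: if_splits)
      ultimately show False using n(1) that by (cases "i < n") auto
    qed
    then have "(\<Sum>i\<in>{1..N}. G i \<omega>) = (\<Sum>i\<in>{n}. G i \<omega>)"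
      using n by (intro sum.mono_neutral_right) auto
    then show ?thesis using n by simp
  next
    case False
    then have "G n \<omega> = 0" if "n \<in> {1..N}" for n using that by (auto simp: G_def split: if_splits)
    then show ?thesis by simp
  qed
  have ind: "indicator ?A \<omega> \<le> (\<Sum>n\<in>{1..N}. G n \<omega>)" for \<omega>
  proof (cases "\<omega> \<in> ?A")
    case True
    define T where "T = {n\<in>{1..N}. L n \<omega>}"
    have T: "finite T" "T \<noteq> {}" using True by (auto simp: T_def)
    have "G (Max T) \<omega> = 1"
    proof -
      have "L (Max T) \<omega>" using Max_in[OF T] by (auto simp: T_def)
      moreover have "\<not> L l \<omega>" if "l \<in> {Max T<..N}" for l
      proof
        assume "L l \<omega>"
        then have "l \<in> T" using that by (auto simp: T_def)
        with T(1) that show False by (auto dest: Max_ge)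
      qed
      ultimately show ?thesis by (auto simp: G_def)
    qed
    moreover have "G (Max T) \<omega> \<le> (\<Sum>n\<in>{1..N}. G n \<omega>)"
      using Max_in[OF T] by (intro member_le_sum) (auto simp: G01 T_def)
    ultimately show ?thesis using True by simp
  qed (simp add: sum_nonneg G01)
  have intk': "integrable iid (\<lambda>\<omega>. \<bar>k (\<omega> i) (\<omega> j)\<bar>)" if "i \<noteq> j" for i j
    using integrable_coordinate_pair_iff[OF that measa] intk by (simp add: case_prod_unfold)
  have intGk: "integrable iid (\<lambda>\<omega>. G n \<omega> * \<bar>k (\<omega> i) (\<omega> j)\<bar>)" if "i \<noteq> j" for n i j
    by (rule Bochner_Integration.integrable_bound[OF intk'[OF that]])
       (auto simp: abs_mult G01 mult_left_le_one_le)
  have intG: "integrable iid (G n)" for n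
    by (rule iid.integrable_const_bound[where B=1]) (auto simp: G01)
  \<comment> \<open>Being the last exceedance involves only U_l with \<open>l \<ge> n\<close>, and
    each of these is symmetric in the first \<open>n\<close> coordinates. The first exceedance would
    involve smaller indices and lose the invariance.\<close>
  have G_transpose: "G n (\<omega> \<circ> Transposition.transpose a b) = G n \<omega>"
    if "a \<in> {1..int n}" "b \<in> {1..int n}" "\<omega> \<in> space iid" for n a b \<omega>
  proof -
    have "L l (\<omega> \<circ> Transposition.transpose a b) \<longleftrightarrow> L l \<omega>" if "n \<le> l" for l
      unfolding L_def
      using \<open>a \<in> _\<close> \<open>b \<in> _\<close> \<open>\<omega> \<in> _\<close> that by (subst U_coord_transpose) (auto simp: space_PiM PiE_iff intro!: sym)
    then show ?thesis unfolding G_def by auto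
  qed
  have exch: "(\<integral>\<omega>. G n \<omega> * \<bar>k (\<omega> i) (\<omega> j)\<bar> \<partial>iid) = (\<integral>\<omega>. G n \<omega> * \<bar>k (\<omega> 1) (\<omega> 2)\<bar> \<partial>iid)"
    if ij: "(i, j) \<in> index_pairs n" for n i j
  proof -
    have ij': "1 \<le> i" "i < j" "j \<le> int n" using ij by (auto simp: index_pairs_def)
    have *: "(\<integral>\<omega>. G n \<omega> * \<bar>k (\<omega> a) (\<omega> b)\<bar> \<partial>iid) =
      (\<integral>\<omega>. G n \<omega> * \<bar>k (\<omega> (Transposition.transpose u v a)) (\<omega> (Transposition.transpose u v b))\<bar> \<partial>iid)"
      if "u \<in> {1..int n}" "v \<in> {1..int n}" for a b u v
    proof -
      have "(\<integral>\<omega>. G n \<omega> * \<bar>k (\<omega> a) (\<omega> b)\<bar> \<partial>iid) =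
         (\<integral>\<omega>. G n (\<omega> \<circ> Transposition.transpose u v) *
            \<bar>k ((\<omega> \<circ> Transposition.transpose u v) a) ((\<omega> \<circ> Transposition.transpose u v) b)\<bar> \<partial>iid)"
        by (subst integral_transpose_iid[where f="\<lambda>\<omega>. G n \<omega> * \<bar>k (\<omega> a) (\<omega> b)\<bar>"]) auto
      then show ?thesis using that by (simp add: G_transpose cong: Bochner_Integration.integral_cong)
    qed
    \<comment> \<open>Exchanging 1 with \<open>i\<close> fixes \<open>j\<close>, since
      \<open>1 \<le> i < j\<close>; exchanging 2 with \<open>j\<close> then fixes 1, since
      \<open>j \<ge> 2\<close>.\<close>
    have "(\<integral>\<omega>. G n \<omega> * \<bar>k (\<omega> i) (\<omega> j)\<bar> \<partial>iid) = (\<integral>\<omega>. G n \<omega> * \<bar>k (\<omega> 1) (\<omega> j)\<bar> \<partial>iid)"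
      using *[of 1 i i j] ij' by (simp add: Transposition.transpose_def)
    also have "\<dots> = (\<integral>\<omega>. G n \<omega> * \<bar>k (\<omega> 1) (\<omega> 2)\<bar> \<partial>iid)"
      using *[of 2 j 1 j] ij' by (simp add: Transposition.transpose_def)
    finally show ?thesis .
  qed
  have step: "x * (\<integral>\<omega>. G n \<omega> \<partial>iid) \<le> (\<integral>\<omega>. G n \<omega> * \<bar>k (\<omega> 1) (\<omega> 2)\<bar> \<partial>iid)"
    if "n \<in> {1..N}" for n
  proof -
    have "x * (real n)\<^sup>2 * (\<integral>\<omega>. G n \<omega> \<partial>iid) = (\<integral>\<omega>. x * (real n)\<^sup>2 * G n \<omega> \<partial>iid)"
      by simp
    also have "\<dots> \<le> (\<integral>\<omega>. (\<Sum>z\<in>index_pairs n. G n \<omega> * \<bar>k (\<omega> (fst z)) (\<omega> (snd z))\<bar>) \<partial>iid)"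
    proof (rule integral_mono)
      show "integrable iid (\<lambda>\<omega>. \<Sum>z\<in>index_pairs n. G n \<omega> * \<bar>k (\<omega> (fst z)) (\<omega> (snd z))\<bar>)"
        by (intro Bochner_Integration.integrable_sum intGk) (auto simp: index_pairs_def)
      fix \<omega>
      have "x * (real n)\<^sup>2 \<le> (\<Sum>z\<in>index_pairs n. \<bar>k (\<omega> (fst z)) (\<omega> (snd z))\<bar>)" if "G n \<omega> = 1"
      proof -
        have "x * (real n)\<^sup>2 \<le> \<bar>U_coord k n \<omega>\<bar>"
          using that by (simp add: G_def L_def split: if_splits)
        also have "\<dots> \<le> (\<Sum>z\<in>index_pairs n. \<bar>k (\<omega> (fst z)) (\<omega> (snd z))\<bar>)"
          unfolding U_coord_eq by (rule sum_abs)
        finally show ?thesis .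
      qed
      moreover have "G n \<omega> = 0 \<or> G n \<omega> = 1" by (simp add: G_def)
      ultimately show "x * (real n)\<^sup>2 * G n \<omega> \<le> (\<Sum>z\<in>index_pairs n. G n \<omega> * \<bar>k (\<omega> (fst z)) (\<omega> (snd z))\<bar>)"
        by auto
    qed (use intG in auto)
    also have "\<dots> = (\<Sum>z\<in>index_pairs n. (\<integral>\<omega>. G n \<omega> * \<bar>k (\<omega> (fst z)) (\<omega> (snd z))\<bar> \<partial>iid))"
      by (intro Bochner_Integration.integral_sum intGk) (auto simp: index_pairs_def)
    also have "\<dots> = real (card (index_pairs n)) * (\<integral>\<omega>. G n \<omega> * \<bar>k (\<omega> 1) (\<omega> 2)\<bar> \<partial>iid)"
      by (subst sum.cong[OF refl exch]) auto
    also have "\<dots> \<le> (real n)\<^sup>2 * (\<integral>\<omega>. G n \<omega> * \<bar>k (\<omega> 1) (\<omega> 2)\<bar> \<partial>iid)"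
    proof (rule mult_right_mono)
      show "real (card (index_pairs n)) \<le> (real n)\<^sup>2"
        using card_index_pairs_le[of n] by linarith
    qed (auto simp: G01)
    \<comment> \<open>The normalisation n^2 cancels against the number of pairs, so what remains is
      one fixed integrand weighted by \<open>G n\<close>. As the weights sum to at most 1, there is
      no loss in summing over \<open>n\<close>.\<close>
    finally have "(real n)\<^sup>2 * (x * (\<integral>\<omega>. G n \<omega> \<partial>iid)) \<le>
        (real n)\<^sup>2 * (\<integral>\<omega>. G n \<omega> * \<bar>k (\<omega> 1) (\<omega> 2)\<bar> \<partial>iid)"
      by (simp add: ac_simps)
    then show ?thesis using that by (subst (asm) mult_le_cancel_left_pos) auto
  qed
  have "x * measure iid ?A = x * (\<integral>\<omega>. indicator ?A \<omega> \<partial>iid)"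
    by simp
  also have "\<dots> \<le> x * (\<integral>\<omega>. (\<Sum>n\<in>{1..N}. G n \<omega>) \<partial>iid)"
    using ind intG \<open>x > 0\<close> by (intro mult_left_mono integral_mono) (auto simp: iid.emeasure_eq_measure)
  also have "\<dots> = (\<Sum>n\<in>{1..N}. x * (\<integral>\<omega>. G n \<omega> \<partial>iid))"
    using intG by (simp add: sum_distrib_left)
  also have "\<dots> \<le> (\<Sum>n\<in>{1..N}. (\<integral>\<omega>. G n \<omega> * \<bar>k (\<omega> 1) (\<omega> 2)\<bar> \<partial>iid))"
    by (intro sum_mono step)
  also have "\<dots> = (\<integral>\<omega>. (\<Sum>n\<in>{1..N}. G n \<omega>) * \<bar>k (\<omega> 1) (\<omega> 2)\<bar> \<partial>iid)"
    using intGk[of 1 2] by (simp add: sum_distrib_right)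
  also have "\<dots> \<le> (\<integral>\<omega>. \<bar>k (\<omega> 1) (\<omega> 2)\<bar> \<partial>iid)"
  proof (rule integral_mono)
    show "integrable iid (\<lambda>\<omega>. (\<Sum>n\<in>{1..N}. G n \<omega>) * \<bar>k (\<omega> 1) (\<omega> 2)\<bar>)"
      using intGk[of 1 2] by (simp add: sum_distrib_right)
    show "(\<Sum>n\<in>{1..N}. G n \<omega>) * \<bar>k (\<omega> 1) (\<omega> 2)\<bar> \<le> \<bar>k (\<omega> 1) (\<omega> 2)\<bar>" for \<omega>
      using mult_right_mono[OF sumG, of "\<bar>k (\<omega> 1) (\<omega> 2)\<bar>"] by simp
  qed (use intk'[of 1 2] in simp)
  also have "\<dots> = (\<integral>z. \<bar>k (fst z) (snd z)\<bar> \<partial>(M \<Otimes>\<^sub>M M))"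
    using integral_coordinate_pair[OF _ measa, of 1 2] by simp
  finally show ?thesis by (simp add: L_def)
qed

section \<open>Truncation and dyadic blocks\<close>

lemma square_expectation_le:
  fixes X :: "'a \<Rightarrow> real"
  assumes "integrable M X" "integrable M (\<lambda>x. (X x)\<^sup>2)"
  shows "(expectation X)\<^sup>2 \<le> expectation (\<lambda>x. (X x)\<^sup>2)"
  using variance_eq[OF assms] variance_positive[of X] by simp

text \<open>The kernel \<open>k x y = b x y - g x - g y + e\<close> is the Hoeffding projection of
  the kept part \<open>b\<close>, with \<open>g\<close> its mean over a section and \<open>e\<close>
  its total mean. Each of the four terms is at most \<open>c\<close> in absolute value and has
  second moment at most that of \<open>b\<close>. The discarded part \<open>r\<close> and the three
  projection terms each have first absolute moment at most that of \<open>r\<close>. This explains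
  the factors 4, 16 and 4.\<close>

lemma degenerate_truncation:
  assumes h: "degenerate h" and inth: "integrable (M \<Otimes>\<^sub>M M) (case_prod h)" and "c > 0"
  obtains k where "degenerate k" "\<And>x y. x \<in> space M \<Longrightarrow> y \<in> space M \<Longrightarrow> \<bar>k x y\<bar> \<le> 4 * c"
    "(\<integral>z. (k (fst z) (snd z))\<^sup>2 \<partial>(M \<Otimes>\<^sub>M M)) \<le>
       16 * (\<integral>z. (if \<bar>h (fst z) (snd z)\<bar> > c then 0 else (h (fst z) (snd z))\<^sup>2) \<partial>(M \<Otimes>\<^sub>M M))"
    "(\<integral>z. \<bar>h (fst z) (snd z) - k (fst z) (snd z)\<bar> \<partial>(M \<Otimes>\<^sub>M M)) \<le>
       4 * (\<integral>z. (if \<bar>h (fst z) (snd z)\<bar> > c then \<bar>h (fst z) (snd z)\<bar> else 0) \<partial>(M \<Otimes>\<^sub>M M))"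
proof -
  have meas: "case_prod h \<in> borel_measurable (M \<Otimes>\<^sub>M M)"
    and sym: "\<And>x y. x \<in> space M \<Longrightarrow> y \<in> space M \<Longrightarrow> h x y = h y x"
    and int_sec: "\<And>x. x \<in> space M \<Longrightarrow> integrable M (\<lambda>y. h y x)"
    and zero: "\<And>x. x \<in> space M \<Longrightarrow> (\<integral>y. h y x \<partial>M) = 0"
    using h by (auto simp: degenerate_def)
  have h_meas[measurable]: "(\<lambda>z. h (fst z) (snd z)) \<in> borel_measurable (M \<Otimes>\<^sub>M M)"
    using meas by (simp add: case_prod_unfold)
  define b where "b x y = (if \<bar>h x y\<bar> > c then 0 else h x y)" for x y
  define r where "r x y = (if \<bar>h x y\<bar> > c then h x y else 0)" for x y
  have h_eq: "h x y = b x y + r x y" for x y by (simp add: b_def r_def)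
  have b_le: "\<bar>b x y\<bar> \<le> c" for x y using \<open>c > 0\<close> by (auto simp: b_def)
  have [measurable]: "(\<lambda>z. b (fst z) (snd z)) \<in> borel_measurable (M \<Otimes>\<^sub>M M)"
    "(\<lambda>z. r (fst z) (snd z)) \<in> borel_measurable (M \<Otimes>\<^sub>M M)"
    unfolding b_def r_def by measurable
  have sec: "(\<lambda>y. f y x) \<in> borel_measurable M"
    if "(\<lambda>z. f (fst z) (snd z)) \<in> borel_measurable (M \<Otimes>\<^sub>M M)" "x \<in> space M" for f :: "'a \<Rightarrow> 'a \<Rightarrow> real" and x
    using measurable_compose[OF measurable_Pair2'[OF that(2)] that(1)] by simp
  have int_b: "integrable M (\<lambda>y. b y x)" "integrable M (\<lambda>y. (b y x)\<^sup>2)" if "x \<in> space M" for x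
  proof -
    have [measurable]: "(\<lambda>y. b y x) \<in> borel_measurable M" by (rule sec[OF _ that]) measurable
    show "integrable M (\<lambda>y. b y x)"
      by (rule integrable_const_bound[where B=c]) (auto simp: b_le)
    show "integrable M (\<lambda>y. (b y x)\<^sup>2)"
      by (rule integrable_const_bound[where B="c\<^sup>2"]) (use b_le \<open>c > 0\<close> in \<open>auto intro!: AE_I2 power2_le_iff_abs_le[THEN iffD2]\<close>)
  qed
  define g where "g x = (\<integral>y. b y x \<partial>M)" for x
  define e where "e = (\<integral>x. g x \<partial>M)"
  have [measurable]: "g \<in> borel_measurable M"
  proof -
    have "(\<lambda>(x, y). b y x) \<in> borel_measurable (M \<Otimes>\<^sub>M M)"
      using measurable_pair_swap[of "\<lambda>z. b (fst z) (snd z)" M M borel] by simp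
    then have "(\<lambda>x. \<integral>y. b y x \<partial>M) \<in> borel_measurable M"
      by (rule borel_measurable_lebesgue_integral)
    then show ?thesis by (simp add: g_def[abs_def])
  qed
  have g_le: "\<bar>g x\<bar> \<le> c" if "x \<in> space M" for x
  proof -
    have "\<bar>g x\<bar> \<le> (\<integral>y. \<bar>b y x\<bar> \<partial>M)" unfolding g_def by (rule integral_abs_bound)
    also have "\<dots> \<le> (\<integral>y. c \<partial>M)" using int_b[OF that] b_le by (intro integral_mono) auto
    finally show ?thesis by (simp add: prob_space)
  qed
  have int_g: "integrable M g" "integrable M (\<lambda>x. (g x)\<^sup>2)" "integrable M (\<lambda>x. \<bar>g x\<bar>)"
  proof -
    show "integrable M g"
      by (rule integrable_const_bound[where B=c]) (auto simp: g_le)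
    then show "integrable M (\<lambda>x. \<bar>g x\<bar>)" by simp
    show "integrable M (\<lambda>x. (g x)\<^sup>2)"
      by (rule integrable_const_bound[where B="c\<^sup>2"]) (use g_le \<open>c > 0\<close> in \<open>auto intro!: AE_I2 power2_le_iff_abs_le[THEN iffD2]\<close>)
  qed
  have e_le: "\<bar>e\<bar> \<le> (\<integral>x. \<bar>g x\<bar> \<partial>M)" unfolding e_def by (rule integral_abs_bound)
  have "(\<integral>x. \<bar>g x\<bar> \<partial>M) \<le> (\<integral>x. c \<partial>M)"
    using int_g g_le by (intro integral_mono) auto
  with e_le have e_c: "\<bar>e\<bar> \<le> c" by (simp add: prob_space)
  have intr: "integrable (M \<Otimes>\<^sub>M M) (\<lambda>z. \<bar>r (fst z) (snd z)\<bar>)"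
    by (rule Bochner_Integration.integrable_bound[OF inth]) (auto simp: r_def case_prod_unfold)
  have intbb: "integrable (M \<Otimes>\<^sub>M M) (\<lambda>z. (b (fst z) (snd z))\<^sup>2)"
    by (rule MM.integrable_const_bound[where B="c\<^sup>2"]) (use b_le \<open>c > 0\<close> in \<open>auto intro!: AE_I2 power2_le_iff_abs_le[THEN iffD2]\<close>)
  \<comment> \<open>Degeneracy of \<open>h\<close> enters here: the kept and the discarded part of a
    section have opposite means, so \<open>g\<close> is controlled by the tail.\<close>
  have g_r: "\<bar>g x\<bar> \<le> (\<integral>y. \<bar>r y x\<bar> \<partial>M)" if "x \<in> space M" for x
  proof -
    have "g x = (\<integral>y. h y x - r y x \<partial>M)" by (simp add: g_def h_eq)
    also have "\<dots> = - (\<integral>y. r y x \<partial>M)"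
    proof -
      have "r y x = h y x - b y x" for y by (simp add: h_eq)
      then have "integrable M (\<lambda>y. r y x)" using int_sec[OF that] int_b[OF that] by simp
      then show ?thesis using int_sec[OF that] zero[OF that] by simp
    qed
    finally show ?thesis using integral_abs_bound[of M "\<lambda>y. r y x"] by simp
  qed
  have Eg: "(\<integral>x. \<bar>g x\<bar> \<partial>M) \<le> (\<integral>z. \<bar>r (fst z) (snd z)\<bar> \<partial>(M \<Otimes>\<^sub>M M))"
  proof -
    have "(\<integral>x. \<bar>g x\<bar> \<partial>M) \<le> (\<integral>x. (\<integral>y. \<bar>r y x\<bar> \<partial>M) \<partial>M)"
      using g_r int_g MM.integrable_snd[of "\<lambda>y x. \<bar>r y x\<bar>"] intr
      by (intro integral_mono) (auto simp: case_prod_unfold)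
    also have "\<dots> = (\<integral>z. \<bar>r (fst z) (snd z)\<bar> \<partial>(M \<Otimes>\<^sub>M M))"
      using MM.integral_snd[of "\<lambda>y x. \<bar>r y x\<bar>"] intr by (simp add: case_prod_unfold)
    finally show ?thesis .
  qed
  \<comment> \<open>Jensen's inequality on each section, then Fubini.\<close>
  have Eg2: "(\<integral>x. (g x)\<^sup>2 \<partial>M) \<le> (\<integral>z. (b (fst z) (snd z))\<^sup>2 \<partial>(M \<Otimes>\<^sub>M M))"
  proof -
    have "(\<integral>x. (g x)\<^sup>2 \<partial>M) \<le> (\<integral>x. (\<integral>y. (b y x)\<^sup>2 \<partial>M) \<partial>M)"
      unfolding g_def
      using int_g MM.integrable_snd[of "\<lambda>y x. (b y x)\<^sup>2"] intbb
      by (intro integral_mono square_expectation_le int_b) (auto simp: case_prod_unfold g_def)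
    also have "\<dots> = (\<integral>z. (b (fst z) (snd z))\<^sup>2 \<partial>(M \<Otimes>\<^sub>M M))"
      using MM.integral_snd[of "\<lambda>y x. (b y x)\<^sup>2"] intbb by (simp add: case_prod_unfold)
    finally show ?thesis .
  qed
  have e2: "e\<^sup>2 \<le> (\<integral>x. (g x)\<^sup>2 \<partial>M)"
    unfolding e_def by (rule square_expectation_le) fact+
  have marg: "integrable (M \<Otimes>\<^sub>M M) (\<lambda>z. f (fst z))" "(\<integral>z. f (fst z) \<partial>(M \<Otimes>\<^sub>M M)) = (\<integral>x. f x \<partial>M)"
     "integrable (M \<Otimes>\<^sub>M M) (\<lambda>z. f (snd z))" "(\<integral>z. f (snd z) \<partial>(M \<Otimes>\<^sub>M M)) = (\<integral>x. f x \<partial>M)"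
    if [measurable]: "f \<in> borel_measurable M" and f_le: "\<And>x. x \<in> space M \<Longrightarrow> \<bar>f x\<bar> \<le> B" for f :: "'a \<Rightarrow> real" and B
  proof -
    show 1: "integrable (M \<Otimes>\<^sub>M M) (\<lambda>z. f (fst z))"
      by (rule MM.integrable_const_bound[where B=B]) (auto intro!: AE_I2 f_le simp: space_pair_measure)
    show 2: "integrable (M \<Otimes>\<^sub>M M) (\<lambda>z. f (snd z))"
      by (rule MM.integrable_const_bound[where B=B]) (auto intro!: AE_I2 f_le simp: space_pair_measure)
    show "(\<integral>z. f (fst z) \<partial>(M \<Otimes>\<^sub>M M)) = (\<integral>x. f x \<partial>M)"
      using MM.integral_fst[of "\<lambda>x y. f x"] 1 by (simp add: case_prod_unfold prob_space)
    show "(\<integral>z. f (snd z) \<partial>(M \<Otimes>\<^sub>M M)) = (\<integral>x. f x \<partial>M)"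
      using MM.integral_snd[of "\<lambda>x y. f y"] 2 by (simp add: case_prod_unfold prob_space)
  qed
  have g2_le: "\<bar>(g x)\<^sup>2\<bar> \<le> c\<^sup>2" if "x \<in> space M" for x
    using g_le[OF that] \<open>c > 0\<close> by (auto intro!: power2_le_iff_abs_le[THEN iffD2])
  have m1: "integrable (M \<Otimes>\<^sub>M M) (\<lambda>z. \<bar>g (fst z)\<bar>)" "(\<integral>z. \<bar>g (fst z)\<bar> \<partial>(M \<Otimes>\<^sub>M M)) = (\<integral>x. \<bar>g x\<bar> \<partial>M)"
     "integrable (M \<Otimes>\<^sub>M M) (\<lambda>z. \<bar>g (snd z)\<bar>)" "(\<integral>z. \<bar>g (snd z)\<bar> \<partial>(M \<Otimes>\<^sub>M M)) = (\<integral>x. \<bar>g x\<bar> \<partial>M)"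
    using marg[of "\<lambda>x. \<bar>g x\<bar>" c] g_le by auto
  have m2: "integrable (M \<Otimes>\<^sub>M M) (\<lambda>z. (g (fst z))\<^sup>2)" "(\<integral>z. (g (fst z))\<^sup>2 \<partial>(M \<Otimes>\<^sub>M M)) = (\<integral>x. (g x)\<^sup>2 \<partial>M)"
     "integrable (M \<Otimes>\<^sub>M M) (\<lambda>z. (g (snd z))\<^sup>2)" "(\<integral>z. (g (snd z))\<^sup>2 \<partial>(M \<Otimes>\<^sub>M M)) = (\<integral>x. (g x)\<^sup>2 \<partial>M)"
    using marg[of "\<lambda>x. (g x)\<^sup>2" "c\<^sup>2"] g2_le by auto
  define k where "k x y = b x y - g x - g y + e" for x y
  have k_meas[measurable]: "(\<lambda>z. k (fst z) (snd z)) \<in> borel_measurable (M \<Otimes>\<^sub>M M)"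
    unfolding k_def by measurable
  have k_le: "\<bar>k x y\<bar> \<le> 4 * c" if "x \<in> space M" "y \<in> space M" for x y
    using b_le[of x y] g_le[OF that(1)] g_le[OF that(2)] e_c unfolding k_def by linarith
  have "degenerate k"
    unfolding degenerate_def
  proof (intro conjI ballI)
    show "case_prod k \<in> borel_measurable (M \<Otimes>\<^sub>M M)" using k_meas by (simp add: case_prod_unfold)
    fix x assume x: "x \<in> space M"
    show "k x y = k y x" if "y \<in> space M" for y
      using sym[OF x that] by (simp add: k_def b_def)
    show "integrable M (\<lambda>y. k y x)" unfolding k_def using int_b[OF x] int_g by auto
    show "(\<integral>y. k y x \<partial>M) = 0"
    proof -
      \<comment> \<open>The four contributions are \<open>g x\<close>, \<open>- e\<close>,
        \<open>- g x\<close> and \<open>e\<close>.\<close>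
      have "(\<integral>y. k y x \<partial>M) = (\<integral>y. b y x \<partial>M) - (\<integral>y. g y \<partial>M) - g x + e"
        unfolding k_def using int_b[OF x] int_g by (simp add: prob_space)
      then show ?thesis by (simp add: e_def g_def[of x])
    qed
  qed
  moreover have "(\<integral>z. (k (fst z) (snd z))\<^sup>2 \<partial>(M \<Otimes>\<^sub>M M)) \<le>
       16 * (\<integral>z. (if \<bar>h (fst z) (snd z)\<bar> > c then 0 else (h (fst z) (snd z))\<^sup>2) \<partial>(M \<Otimes>\<^sub>M M))"
  proof -
    have ksq: "(k x y)\<^sup>2 \<le> 4 * ((b x y)\<^sup>2 + (g x)\<^sup>2 + (g y)\<^sup>2 + e\<^sup>2)" for x y
    proof -
      have "(s - t - u + v)\<^sup>2 \<le> 4 * (s\<^sup>2 + t\<^sup>2 + u\<^sup>2 + v\<^sup>2)" for s t u v :: real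
      proof -
        \<comment> \<open>Lagrange's identity: the six squares add up to the difference of the two
          sides, being the squared differences of the numbers s, -t, -u, v taken in pairs.\<close>
        have "0 \<le> (s + t)\<^sup>2 + (s + u)\<^sup>2 + (s - v)\<^sup>2 + (t - u)\<^sup>2 + (t + v)\<^sup>2 + (u + v)\<^sup>2" by simp
        then show ?thesis by (simp add: power2_eq_square algebra_simps)
      qed
      then show ?thesis by (simp add: k_def)
    qed
    have "(\<integral>z. (k (fst z) (snd z))\<^sup>2 \<partial>(M \<Otimes>\<^sub>M M)) \<le>
      (\<integral>z. 4 * ((b (fst z) (snd z))\<^sup>2 + (g (fst z))\<^sup>2 + (g (snd z))\<^sup>2 + e\<^sup>2) \<partial>(M \<Otimes>\<^sub>M M))"
    proof (rule integral_mono)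
      show "integrable (M \<Otimes>\<^sub>M M) (\<lambda>z. (k (fst z) (snd z))\<^sup>2)"
      proof (rule MM.integrable_const_bound[where B="(4 * c)\<^sup>2"])
        show "AE z in M \<Otimes>\<^sub>M M. norm ((k (fst z) (snd z))\<^sup>2) \<le> (4 * c)\<^sup>2"
          using k_le \<open>c > 0\<close> unfolding real_norm_def abs_power2
          by (intro AE_I2 power2_le_iff_abs_le[THEN iffD2]) (auto simp: space_pair_measure)
      qed measurable
    qed (use intbb m2 ksq in auto)
    also have "\<dots> = 4 * ((\<integral>z. (b (fst z) (snd z))\<^sup>2 \<partial>(M \<Otimes>\<^sub>M M)) + 2 * (\<integral>x. (g x)\<^sup>2 \<partial>M) + e\<^sup>2)"
      using intbb m2 by (simp add: MM.prob_space)
    also have "\<dots> \<le> 16 * (\<integral>z. (b (fst z) (snd z))\<^sup>2 \<partial>(M \<Otimes>\<^sub>M M))"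
      using Eg2 e2 by simp
    also have "(\<lambda>z. (b (fst z) (snd z))\<^sup>2) =
        (\<lambda>z. if \<bar>h (fst z) (snd z)\<bar> > c then 0 else (h (fst z) (snd z))\<^sup>2)"
      by (auto simp: b_def)
    finally show ?thesis .
  qed
  moreover have "(\<integral>z. \<bar>h (fst z) (snd z) - k (fst z) (snd z)\<bar> \<partial>(M \<Otimes>\<^sub>M M)) \<le>
       4 * (\<integral>z. (if \<bar>h (fst z) (snd z)\<bar> > c then \<bar>h (fst z) (snd z)\<bar> else 0) \<partial>(M \<Otimes>\<^sub>M M))"
  proof -
    have "(\<integral>z. \<bar>h (fst z) (snd z) - k (fst z) (snd z)\<bar> \<partial>(M \<Otimes>\<^sub>M M)) \<le>
       (\<integral>z. \<bar>r (fst z) (snd z)\<bar> + \<bar>g (fst z)\<bar> + \<bar>g (snd z)\<bar> + \<bar>e\<bar> \<partial>(M \<Otimes>\<^sub>M M))"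
    proof (rule integral_mono)
      have "integrable (M \<Otimes>\<^sub>M M) (\<lambda>z. k (fst z) (snd z))"
        by (rule MM.integrable_const_bound[where B="4 * c"])
          (use k_le in \<open>auto intro!: AE_I2 simp: space_pair_measure\<close>)
      then show "integrable (M \<Otimes>\<^sub>M M) (\<lambda>z. \<bar>h (fst z) (snd z) - k (fst z) (snd z)\<bar>)"
        using inth by (auto simp: case_prod_unfold)
      show "\<bar>h (fst z) (snd z) - k (fst z) (snd z)\<bar> \<le>
         \<bar>r (fst z) (snd z)\<bar> + \<bar>g (fst z)\<bar> + \<bar>g (snd z)\<bar> + \<bar>e\<bar>" for z
        unfolding k_def h_eq by linarith
    qed (use intr m1 in auto)
    also have "\<dots> = (\<integral>z. \<bar>r (fst z) (snd z)\<bar> \<partial>(M \<Otimes>\<^sub>M M)) + 2 * (\<integral>x. \<bar>g x\<bar> \<partial>M) + \<bar>e\<bar>"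
      using intr m1 by (simp add: MM.prob_space)
    also have "\<dots> \<le> 4 * (\<integral>z. \<bar>r (fst z) (snd z)\<bar> \<partial>(M \<Otimes>\<^sub>M M))"
      using Eg e_le by simp
    also have "(\<lambda>z. \<bar>r (fst z) (snd z)\<bar>) =
        (\<lambda>z. if \<bar>h (fst z) (snd z)\<bar> > c then \<bar>h (fst z) (snd z)\<bar> else 0)"
      by (auto simp: r_def)
    finally show ?thesis .
  qed
  ultimately show thesis using k_le that by blast
qed

text \<open>The level is split into halves. For \<open>k\<close> the maximal inequality is applied
  at \<open>c / 2\<close>. The remainder is dominated for all \<open>n \<le> m\<close> at once by
  \<open>S\<close>, the sum of absolute values over all pairs up to \<open>m\<close>, so a single
  use of Markov's inequality suffices.\<close>

lemma prob_U_coord_le_truncation: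
  assumes h: "degenerate h" and inth: "integrable (M \<Otimes>\<^sub>M M) (case_prod h)" and "c > 0"
  shows "measure iid {\<omega> \<in> space iid. \<exists>n\<le>m. \<bar>U_coord h n \<omega>\<bar> > c} \<le>
    32 * (real m)\<^sup>2 / c\<^sup>2 * (\<integral>z. (if \<bar>h (fst z) (snd z)\<bar> > c then 0 else (h (fst z) (snd z))\<^sup>2) \<partial>(M \<Otimes>\<^sub>M M)) +
    4 * (real m)\<^sup>2 / c * (\<integral>z. (if \<bar>h (fst z) (snd z)\<bar> > c then \<bar>h (fst z) (snd z)\<bar> else 0) \<partial>(M \<Otimes>\<^sub>M M))"
    (is "measure iid ?E \<le> 32 * _ / _ * ?I2 + 4 * _ / _ * ?I1")
proof -
  obtain k where k: "degenerate k" "\<And>x y. x \<in> space M \<Longrightarrow> y \<in> space M \<Longrightarrow> \<bar>k x y\<bar> \<le> 4 * c"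
    "(\<integral>z. (k (fst z) (snd z))\<^sup>2 \<partial>(M \<Otimes>\<^sub>M M)) \<le> 16 * ?I2"
    "(\<integral>z. \<bar>h (fst z) (snd z) - k (fst z) (snd z)\<bar> \<partial>(M \<Otimes>\<^sub>M M)) \<le> 4 * ?I1"
    using degenerate_truncation[OF h inth \<open>c > 0\<close>] by blast
  define d where "d x y = h x y - k x y" for x y
  have meas: "case_prod h \<in> borel_measurable (M \<Otimes>\<^sub>M M)" "case_prod k \<in> borel_measurable (M \<Otimes>\<^sub>M M)"
    using h k by (auto simp: degenerate_def)
  have measd: "case_prod (\<lambda>x y. \<bar>d x y\<bar>) \<in> borel_measurable (M \<Otimes>\<^sub>M M)"
    using borel_measurable_abs[OF borel_measurable_diff[OF meas]] by (simp add: case_prod_unfold d_def)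
  note [measurable] = measurable_U_coord[OF meas(1)] measurable_U_coord[OF meas(2)]
    measurable_coordinate_pair[OF measd]
  have "integrable (M \<Otimes>\<^sub>M M) (case_prod k)"
    by (rule MM.integrable_const_bound[where B="4 * c"])
       (use k meas in \<open>auto intro!: AE_I2 simp: space_pair_measure\<close>)
  then have "integrable (M \<Otimes>\<^sub>M M) (\<lambda>z. \<bar>d (fst z) (snd z)\<bar>)"
    using inth by (auto simp: d_def case_prod_unfold)
  then have intd: "integrable iid (\<lambda>\<omega>. \<bar>d (\<omega> i) (\<omega> j)\<bar>)" if "i \<noteq> j" for i j
    using integrable_coordinate_pair_iff[OF that measd] by simp
  define S where "S \<omega> = (\<Sum>z\<in>index_pairs m. \<bar>d (\<omega> (fst z)) (\<omega> (snd z))\<bar>)" for \<omega>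
  have intS: "integrable iid S"
    unfolding S_def[abs_def] by (intro Bochner_Integration.integrable_sum intd) (auto simp: index_pairs_def)
  let ?E1 = "{\<omega> \<in> space iid. \<exists>n\<in>{..m}. \<bar>U_coord k n \<omega>\<bar> > c / 2}"
  let ?E2 = "{\<omega> \<in> space iid. S \<omega> \<ge> c / 2}"
  have [measurable]: "?E1 \<in> sets iid" by measurable
  have [measurable]: "S \<in> borel_measurable iid" using intS by simp
  have "?E \<subseteq> ?E1 \<union> ?E2"
  proof
    fix \<omega> assume "\<omega> \<in> ?E"
    then obtain n where n: "n \<le> m" "\<bar>U_coord h n \<omega>\<bar> > c" and \<omega>: "\<omega> \<in> space iid" by auto
    have "\<bar>U_coord h n \<omega> - U_coord k n \<omega>\<bar> \<le> (\<Sum>z\<in>index_pairs n. \<bar>d (\<omega> (fst z)) (\<omega> (snd z))\<bar>)"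
      unfolding U_coord_diff[symmetric] unfolding U_coord_eq d_def by (rule sum_abs)
    also have "\<dots> \<le> S \<omega>"
      unfolding S_def using index_pairs_mono[OF n(1)] by (intro sum_mono2) auto
    finally have "\<bar>U_coord k n \<omega>\<bar> > c / 2 \<or> S \<omega> \<ge> c / 2" using n(2) by linarith
    with n \<omega> show "\<omega> \<in> ?E1 \<union> ?E2" by auto
  qed
  then have "measure iid ?E \<le> measure iid (?E1 \<union> ?E2)"
    by (intro iid.finite_measure_mono) auto
  also have "\<dots> \<le> measure iid ?E1 + measure iid ?E2"
    by (intro measure_Un_le) auto
  also have "measure iid ?E1 \<le> 32 * (real m)\<^sup>2 / c\<^sup>2 * ?I2"
  proof -
    have "(c / 2)\<^sup>2 * measure iid ?E1 \<le> (\<integral>\<omega>. (U_coord k m \<omega>)\<^sup>2 \<partial>iid)"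
      using maximal_inequality_degenerate[OF k(1,2), of "c / 2" m] \<open>c > 0\<close>
      by (simp only: Bex_def atMost_iff)
    also have "\<dots> \<le> (real m)\<^sup>2 / 2 * (\<integral>z. (k (fst z) (snd z))\<^sup>2 \<partial>(M \<Otimes>\<^sub>M M))"
      by (rule second_moment_U_coord[OF k(1,2)])
    also have "\<dots> \<le> (real m)\<^sup>2 / 2 * (16 * ?I2)"
      using k(3) by (intro mult_left_mono) auto
    finally show ?thesis using \<open>c > 0\<close> by (simp add: field_simps)
  qed
  also have "measure iid ?E2 \<le> 4 * (real m)\<^sup>2 / c * ?I1"
  proof -
    have "measure iid ?E2 \<le> (\<integral>\<omega>. S \<omega> \<partial>iid) / (c / 2)"
      using \<open>c > 0\<close> by (intro integral_Markov_inequality_measure[OF intS, of "{}"])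
        (auto simp: S_def intro!: AE_I2 sum_nonneg)
    also have "(\<integral>\<omega>. S \<omega> \<partial>iid) = (\<Sum>z\<in>index_pairs m. (\<integral>\<omega>. \<bar>d (\<omega> (fst z)) (\<omega> (snd z))\<bar> \<partial>iid))"
      unfolding S_def by (intro Bochner_Integration.integral_sum intd) (auto simp: index_pairs_def)
    also have "\<dots> = (\<Sum>z\<in>index_pairs m. (\<integral>z. \<bar>d (fst z) (snd z)\<bar> \<partial>(M \<Otimes>\<^sub>M M)))"
      by (intro sum.cong refl integral_coordinate_pair measd) (auto simp: index_pairs_def)
    also have "\<dots> = real (card (index_pairs m)) * (\<integral>z. \<bar>d (fst z) (snd z)\<bar> \<partial>(M \<Otimes>\<^sub>M M))"
      by simp
    also have "\<dots> \<le> (real m)\<^sup>2 / 2 * (4 * ?I1)"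
      using k(4) card_index_pairs_le[of m] by (intro mult_mono) (auto simp: d_def)
    finally show ?thesis using \<open>c > 0\<close> by (simp add: divide_right_mono field_simps)
  qed
  finally show ?thesis by simp
qed

text \<open>Consecutive blocks share an endpoint, which is harmless under a union bound. The
  threshold keeps its dependence on \<open>n\<close>, so that the union of all blocks covers the
  event for the supremum.\<close>

definition block_event :: "real \<Rightarrow> ('a \<Rightarrow> 'a \<Rightarrow> real) \<Rightarrow> real \<Rightarrow> nat \<Rightarrow> (int \<Rightarrow> 'a) set" where
  "block_event p h x N =
     {\<omega> \<in> space iid. \<exists>n\<in>{2 ^ N..2 ^ Suc N}. \<bar>U_coord h n \<omega>\<bar> > x * real n powr (2 / p)}"

lemma sets_block_event:
  assumes "degenerate h"
  shows "block_event p h x N \<in> sets iid"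
proof -
  have [measurable]: "U_coord h n \<in> borel_measurable iid" for n
    using assms by (intro measurable_U_coord) (simp add: degenerate_def)
  show ?thesis unfolding block_event_def by measurable
qed

lemma integrable_kernel_of_powr:
  assumes h: "degenerate h" and "1 \<le> p"
    and int: "integrable (M \<Otimes>\<^sub>M M) (\<lambda>z. \<bar>h (fst z) (snd z)\<bar> powr p)"
  shows "integrable (M \<Otimes>\<^sub>M M) (case_prod h)"
  unfolding case_prod_unfold
proof (rule integrable_of_powr[OF MM.finite_measure_axioms \<open>1 \<le> p\<close> int])
  show "(\<lambda>z. h (fst z) (snd z)) \<in> borel_measurable (M \<Otimes>\<^sub>M M)"
    using h by (simp add: degenerate_def case_prod_unfold)
qed

text \<open>The sum is kept finite, so that it passes through the integral by linearity; the
  pointwise estimate is uniform in \<open>K\<close>. Dividing the kernel by \<open>x\<close> turns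
  the truncation levels into the numbers \<open>b N\<close>, free of \<open>x\<close>.\<close>

lemma sum_prob_block_event_le:
  assumes h: "degenerate h" and p: "1 < p" "p < 2" and "x > 0"
    and int: "integrable (M \<Otimes>\<^sub>M M) (\<lambda>z. \<bar>h (fst z) (snd z)\<bar> powr p)"
  shows "(\<Sum>N<K. measure iid (block_event p h x N)) \<le>
    block_const p * (\<integral>z. \<bar>h (fst z) (snd z)\<bar> powr p \<partial>(M \<Otimes>\<^sub>M M)) / x powr p"
proof -
  have meas: "case_prod h \<in> borel_measurable (M \<Otimes>\<^sub>M M)" using h by (simp add: degenerate_def)
  then have [measurable]: "(\<lambda>z. h (fst z) (snd z)) \<in> borel_measurable (M \<Otimes>\<^sub>M M)"
    by (simp add: case_prod_unfold)
  have inth: "integrable (M \<Otimes>\<^sub>M M) (\<lambda>z. h (fst z) (snd z))"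
    using integrable_kernel_of_powr[OF h less_imp_le[OF p(1)] int] by (simp add: case_prod_unfold)
  define H where "H z = \<bar>h (fst z) (snd z)\<bar> / x" for z
  have [measurable]: "H \<in> borel_measurable (M \<Otimes>\<^sub>M M)" unfolding H_def by measurable
  define b where "b N = (4::real) powr (real N / p)" for N
  have b0: "b N > 0" for N by (simp add: b_def)
  have H0: "0 \<le> H z" for z using \<open>x > 0\<close> by (simp add: H_def)
  have intH: "integrable (M \<Otimes>\<^sub>M M) H" unfolding H_def[abs_def] using inth by auto
  have i2: "integrable (M \<Otimes>\<^sub>M M) (\<lambda>z. if H z > b N then 0 else (H z)\<^sup>2)" for N
    by (rule MM.integrable_const_bound[where B="(b N)\<^sup>2"]) (use H0 b0 in \<open>auto intro!: AE_I2 power_mono\<close>)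
  have i1: "integrable (M \<Otimes>\<^sub>M M) (\<lambda>z. if H z > b N then H z else 0)" for N
    by (rule Bochner_Integration.integrable_bound[OF intH]) auto
  have block: "measure iid (block_event p h x N) \<le>
      (\<integral>z. 128 * (4 ^ N / (b N)\<^sup>2) * (if H z > b N then 0 else (H z)\<^sup>2) +
                  16 * (4 ^ N / b N) * (if H z > b N then H z else 0) \<partial>(M \<Otimes>\<^sub>M M))" for N
  proof -
    \<comment> \<open>This is the threshold at the left end of the block, since \<open>b N\<close>
      equals \<open>(2 ^ N) powr (2 / p)\<close>.\<close>
    define c where "c = x * b N"
    have "c > 0" using b0 \<open>x > 0\<close> by (simp add: c_def)
    have gt: "\<bar>h (fst z) (snd z)\<bar> > c \<longleftrightarrow> H z > b N" for z
      using \<open>x > 0\<close> by (simp add: c_def H_def field_simps)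
    have hx: "\<bar>h (fst z) (snd z)\<bar> = x * H z" for z using \<open>x > 0\<close> by (simp add: H_def)
    have hx2: "(h (fst z) (snd z))\<^sup>2 = x\<^sup>2 * (H z)\<^sup>2" for z
      using hx[of z] by (metis power2_abs power_mult_distrib)
    have m2: "(real (2 ^ Suc N))\<^sup>2 = 4 * 4 ^ N"
      by (simp add: power2_eq_square power_mult_distrib[symmetric])
    note [measurable] = measurable_U_coord[OF meas]
    have "block_event p h x N \<subseteq> {\<omega> \<in> space iid. \<exists>n\<le>2 ^ Suc N. \<bar>U_coord h n \<omega>\<bar> > c}"
    proof
      fix \<omega> assume "\<omega> \<in> block_event p h x N"
      then obtain n where \<omega>: "\<omega> \<in> space iid" and n: "2 ^ N \<le> n" "n \<le> 2 ^ Suc N"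
        "\<bar>U_coord h n \<omega>\<bar> > x * real n powr (2 / p)"
        by (auto simp: block_event_def)
      have "b N = (2 ^ N) powr (2 / p)"
      proof -
        have "(2 ^ N) powr (2 / p) = (2::real) powr (2 * (real N / p))"
          by (simp add: powr_realpow[symmetric] powr_powr mult.commute)
        also have "\<dots> = (2 powr 2) powr (real N / p)" by (simp only: powr_powr)
        also have "\<dots> = b N" unfolding b_def by simp
        finally show ?thesis ..
      qed
      also have "\<dots> \<le> real n powr (2 / p)"
        using of_nat_mono[OF n(1), where 'a=real] p by (intro powr_mono2) auto
      finally have "c \<le> x * real n powr (2 / p)"
        using \<open>x > 0\<close> by (simp add: c_def)
      with n \<omega> show "\<omega> \<in> {\<omega> \<in> space iid. \<exists>n\<le>2 ^ Suc N. \<bar>U_coord h n \<omega>\<bar> > c}" by force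
    qed
    then have "measure iid (block_event p h x N) \<le>
        measure iid {\<omega> \<in> space iid. \<exists>n\<le>2 ^ Suc N. \<bar>U_coord h n \<omega>\<bar> > c}"
    proof (rule iid.finite_measure_mono)
      have "{\<omega> \<in> space iid. \<exists>n\<in>{..2 ^ Suc N}. \<bar>U_coord h n \<omega>\<bar> > c} \<in> sets iid" by measurable
      then show "{\<omega> \<in> space iid. \<exists>n\<le>2 ^ Suc N. \<bar>U_coord h n \<omega>\<bar> > c} \<in> sets iid" by simp
    qed
    also have "\<dots> \<le>
      32 * (4 * 4 ^ N) / c\<^sup>2 * (\<integral>z. (if H z > b N then 0 else x\<^sup>2 * (H z)\<^sup>2) \<partial>(M \<Otimes>\<^sub>M M)) +
      4 * (4 * 4 ^ N) / c * (\<integral>z. (if H z > b N then x * H z else 0) \<partial>(M \<Otimes>\<^sub>M M))"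
      using prob_U_coord_le_truncation[OF h _ \<open>c > 0\<close>, of "2 ^ Suc N"] inth
      unfolding gt unfolding hx2 hx m2 by (simp add: case_prod_unfold)
    also have "\<dots> = (\<integral>z. 32 * (4 * 4 ^ N) / c\<^sup>2 * (if H z > b N then 0 else x\<^sup>2 * (H z)\<^sup>2) +
       4 * (4 * 4 ^ N) / c * (if H z > b N then x * H z else 0) \<partial>(M \<Otimes>\<^sub>M M))"
    proof (subst Bochner_Integration.integral_add)
      have "(if H z > b N then 0 else x\<^sup>2 * (H z)\<^sup>2) = x\<^sup>2 * (if H z > b N then 0 else (H z)\<^sup>2)" for z
        by simp
      then show "integrable (M \<Otimes>\<^sub>M M) (\<lambda>z. 32 * (4 * 4 ^ N) / c\<^sup>2 * (if H z > b N then 0 else x\<^sup>2 * (H z)\<^sup>2))"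
        by (simp only:) (intro integrable_mult_right i2)
      have "(if H z > b N then x * H z else 0) = x * (if H z > b N then H z else 0)" for z
        by simp
      then show "integrable (M \<Otimes>\<^sub>M M) (\<lambda>z. 4 * (4 * 4 ^ N) / c * (if H z > b N then x * H z else 0))"
        by (simp only:) (intro integrable_mult_right i1)
    qed simp
    also have "\<dots> = (\<integral>z. 128 * (4 ^ N / (b N)\<^sup>2) * (if H z > b N then 0 else (H z)\<^sup>2) +
                  16 * (4 ^ N / b N) * (if H z > b N then H z else 0) \<partial>(M \<Otimes>\<^sub>M M))"
      using \<open>x > 0\<close> b0[of N]
      by (intro Bochner_Integration.integral_cong) (auto simp: c_def power_mult_distrib field_simps)
    finally show ?thesis .
  qed
  have "(\<Sum>N<K. measure iid (block_event p h x N)) \<le>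
      (\<Sum>N<K. \<integral>z. 128 * (4 ^ N / (b N)\<^sup>2) * (if H z > b N then 0 else (H z)\<^sup>2) +
                  16 * (4 ^ N / b N) * (if H z > b N then H z else 0) \<partial>(M \<Otimes>\<^sub>M M))"
    by (intro sum_mono block)
  also have "\<dots> = (\<integral>z. (\<Sum>N<K. 128 * (4 ^ N / (b N)\<^sup>2) * (if H z > b N then 0 else (H z)\<^sup>2) +
                  16 * (4 ^ N / b N) * (if H z > b N then H z else 0)) \<partial>(M \<Otimes>\<^sub>M M))"
    using i1 i2
    by (intro Bochner_Integration.integral_sum[symmetric] Bochner_Integration.integrable_add integrable_mult_right)
  also have "\<dots> \<le> (\<integral>z. block_const p / x powr p * \<bar>h (fst z) (snd z)\<bar> powr p \<partial>(M \<Otimes>\<^sub>M M))"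
  proof (rule integral_mono)
    show "integrable (M \<Otimes>\<^sub>M M) (\<lambda>z. \<Sum>N<K. 128 * (4 ^ N / (b N)\<^sup>2) * (if H z > b N then 0 else (H z)\<^sup>2) +
                  16 * (4 ^ N / b N) * (if H z > b N then H z else 0))"
      using i1 i2
      by (intro Bochner_Integration.integrable_sum Bochner_Integration.integrable_add integrable_mult_right)
    fix z
    have "block_const p * H z powr p = block_const p / x powr p * \<bar>h (fst z) (snd z)\<bar> powr p"
      using \<open>x > 0\<close> by (simp add: H_def powr_divide)
    then show "(\<Sum>N<K. 128 * (4 ^ N / (b N)\<^sup>2) * (if H z > b N then 0 else (H z)\<^sup>2) +
                  16 * (4 ^ N / b N) * (if H z > b N then H z else 0)) \<le> block_const p / x powr p * \<bar>h (fst z) (snd z)\<bar> powr p"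
      using sum_truncation_le[OF p H0[of z], of K] unfolding b_def by (simp only:)
  qed (use int in auto)
  finally show ?thesis by simp
qed

section \<open>Convergence and the weak-type inequality\<close>

lemma summable_prob_block_event:
  assumes "degenerate h" "1 < p" "p < 2" "x > 0"
    "integrable (M \<Otimes>\<^sub>M M) (\<lambda>z. \<bar>h (fst z) (snd z)\<bar> powr p)"
  shows "summable (\<lambda>N. measure iid (block_event p h x N))"
  using sum_prob_block_event_le[OF assms] by (intro summableI_nonneg_bounded) auto

lemma U_coord_tendsto_zero_gt_1:
  assumes h: "degenerate h" and p: "1 < p" "p < 2"
    and int: "integrable (M \<Otimes>\<^sub>M M) (\<lambda>z. \<bar>h (fst z) (snd z)\<bar> powr p)"
  shows "AE \<omega> in iid. (\<lambda>n. \<bar>U_coord h n \<omega>\<bar> / real n powr (2 / p)) \<longlonglongrightarrow> 0"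
proof -
  have "AE \<omega> in iid. eventually (\<lambda>N. \<omega> \<in> space iid - block_event p h (1 / real (Suc j)) N) sequentially" for j
    using h p int
    by (intro borel_cantelli_AE1 sets_block_event summable_prob_block_event) (auto simp: iid.emeasure_eq_measure)
  then have "AE \<omega> in iid. \<forall>j. eventually (\<lambda>N. \<omega> \<in> space iid - block_event p h (1 / real (Suc j)) N) sequentially"
    by (simp add: AE_all_countable)
  then show ?thesis
  proof eventually_elim
    case (elim \<omega>)
    show ?case
    proof (rule tendsto_zero_if_eventually_le)
      fix j
      from elim obtain N0 where N0: "\<And>N. N \<ge> N0 \<Longrightarrow> \<omega> \<in> space iid - block_event p h (1 / real (Suc j)) N"
        unfolding eventually_sequentially by blast
      show "\<forall>\<^sub>F n in sequentially. \<bar>U_coord h n \<omega>\<bar> / real n powr (2 / p) \<le> 1 / real (Suc j)"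
        unfolding eventually_sequentially
      proof (intro exI allI impI)
        \<comment> \<open>Every such \<open>n\<close> lies in a block of index at least
          \<open>N0\<close>, so a statement about all late blocks is one about all large
          \<open>n\<close>.\<close>
        fix n :: nat assume n: "2 ^ N0 \<le> n"
        have "1 \<le> n" using n one_le_power[of "2::nat" N0] by linarith
        then obtain N where N: "2 ^ N \<le> n" "n < 2 ^ (N + 1)" using ex_power_ivl1[of 2 n] by auto
        have "(2::nat) ^ N0 < 2 ^ (N + 1)" using n N by linarith
        then have "N0 \<le> N" by (simp add: power_strict_increasing_iff del: power_Suc)
        from N0[OF this] N have "\<not> \<bar>U_coord h n \<omega>\<bar> > 1 / real (Suc j) * real n powr (2 / p)"
          by (auto simp: block_event_def)
        with \<open>1 \<le> n\<close> show "\<bar>U_coord h n \<omega>\<bar> / real n powr (2 / p) \<le> 1 / real (Suc j)"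
          by (simp add: not_less divide_le_eq)
      qed
    qed simp
  qed
qed

text \<open>The bound for a finite horizon is uniform in \<open>N\<close> and the events increase
  with \<open>N\<close>, so continuity of the measure from below passes to the limit.\<close>

lemma maximal_inequality_symmetric_all:
  assumes meas: "case_prod k \<in> borel_measurable (M \<Otimes>\<^sub>M M)"
    and sym: "\<And>x y. x \<in> space M \<Longrightarrow> y \<in> space M \<Longrightarrow> k x y = k y x"
    and int: "integrable (M \<Otimes>\<^sub>M M) (case_prod k)"
    and "x > 0"
  shows "x * measure iid {\<omega> \<in> space iid. \<exists>n\<ge>1. \<bar>U_coord k n \<omega>\<bar> > x * (real n)\<^sup>2} \<le>
    (\<integral>z. \<bar>k (fst z) (snd z)\<bar> \<partial>(M \<Otimes>\<^sub>M M))"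
proof -
  note [measurable] = measurable_U_coord[OF meas]
  define A where "A N = {\<omega> \<in> space iid. \<exists>n\<in>{1..N}. \<bar>U_coord k n \<omega>\<bar> > x * (real n)\<^sup>2}" for N
  have "(\<lambda>N. measure iid (A N)) \<longlonglongrightarrow> measure iid (\<Union>N. A N)"
  proof (rule iid.finite_Lim_measure_incseq)
    have "A N \<in> sets iid" for N unfolding A_def by measurable
    then show "range A \<subseteq> sets iid" by auto
    show "incseq A" unfolding incseq_def A_def by fastforce
  qed
  then have "(\<lambda>N. x * measure iid (A N)) \<longlonglongrightarrow> x * measure iid (\<Union>N. A N)"
    by (intro tendsto_mult_left)
  then have "x * measure iid (\<Union>N. A N) \<le> (\<integral>z. \<bar>k (fst z) (snd z)\<bar> \<partial>(M \<Otimes>\<^sub>M M))"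
    using maximal_inequality_symmetric[OF meas sym int \<open>x > 0\<close>]
    by (intro LIMSEQ_le_const2) (auto simp: A_def)
  also have "(\<Union>N. A N) = {\<omega> \<in> space iid. \<exists>n\<ge>1. \<bar>U_coord k n \<omega>\<bar> > x * (real n)\<^sup>2}"
    by (auto simp: A_def) (metis One_nat_def atLeastAtMost_iff order_refl)
  finally show ?thesis .
qed

text \<open>The event \<open>L x\<close> of infinitely many exceedances does not involve the
  truncation level, but it is bounded by the tail of |h| beyond \<open>Suc c\<close>, for every
  \<open>c\<close>. Letting \<open>c\<close> grow forces its probability to be 0. The successor
  keeps the level positive.\<close>

lemma U_coord_tendsto_zero_1:
  assumes h: "degenerate h" and inth: "integrable (M \<Otimes>\<^sub>M M) (case_prod h)"
  shows "AE \<omega> in iid. (\<lambda>n. \<bar>U_coord h n \<omega>\<bar> / (real n)\<^sup>2) \<longlonglongrightarrow> 0"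
proof -
  have meas: "case_prod h \<in> borel_measurable (M \<Otimes>\<^sub>M M)" using h by (simp add: degenerate_def)
  then have [measurable]: "(\<lambda>z. h (fst z) (snd z)) \<in> borel_measurable (M \<Otimes>\<^sub>M M)"
    by (simp add: case_prod_unfold)
  note [measurable] = measurable_U_coord[OF meas]
  define tail where
    "tail c = (\<integral>z. (if \<bar>h (fst z) (snd z)\<bar> > real (Suc c) then \<bar>h (fst z) (snd z)\<bar> else 0) \<partial>(M \<Otimes>\<^sub>M M))"
    for c :: nat
  have "tail \<longlonglongrightarrow> (\<integral>z. 0 \<partial>(M \<Otimes>\<^sub>M M))"
    unfolding tail_def
  proof (rule integral_dominated_convergence[where w="\<lambda>z. \<bar>h (fst z) (snd z)\<bar>"])
    show "integrable (M \<Otimes>\<^sub>M M) (\<lambda>z. \<bar>h (fst z) (snd z)\<bar>)"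
      using inth by (simp add: case_prod_unfold)
    show "AE z in M \<Otimes>\<^sub>M M. (\<lambda>c. if \<bar>h (fst z) (snd z)\<bar> > real (Suc c) then \<bar>h (fst z) (snd z)\<bar> else 0)
        \<longlonglongrightarrow> 0"
    proof (intro AE_I2 tendsto_eventually)
      fix z
      obtain m :: nat where m: "\<bar>h (fst z) (snd z)\<bar> \<le> real m" using real_arch_simple by blast
      show "\<forall>\<^sub>F c in sequentially.
          (if \<bar>h (fst z) (snd z)\<bar> > real (Suc c) then \<bar>h (fst z) (snd z)\<bar> else 0) = 0"
        using eventually_ge_at_top[of m] by eventually_elim (use m in auto)
    qed
  qed auto
  then have tail0: "tail \<longlonglongrightarrow> 0" by simp
  \<comment> \<open>The factor 2 leaves \<open>x\<close> times n^2 for each summand of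
    \<open>h = k + d\<close>. Since the bounded part \<open>k\<close> stays within its share from
    some time on, \<open>d\<close> must exceed its own at some \<open>n \<ge> 1\<close>.\<close>
  define L where "L x = {\<omega> \<in> space iid. \<exists>\<^sub>\<infinity>n. \<bar>U_coord h n \<omega>\<bar> > 2 * x * (real n)\<^sup>2}" for x
  have L[measurable]: "L x \<in> sets iid" for x unfolding L_def INFM_nat by measurable
  have bound: "x * measure iid (L x) \<le> 4 * tail c" if "x > 0" for x c
  proof -
    have c: "real (Suc c) > 0" by simp
    obtain k where k: "degenerate k" "\<And>x y. x \<in> space M \<Longrightarrow> y \<in> space M \<Longrightarrow> \<bar>k x y\<bar> \<le> 4 * real (Suc c)"
      "(\<integral>z. \<bar>h (fst z) (snd z) - k (fst z) (snd z)\<bar> \<partial>(M \<Otimes>\<^sub>M M)) \<le> 4 * tail c"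
    proof (rule degenerate_truncation[OF h inth c], goal_cases)
      case (1 k)
      show ?case by (rule that[OF 1(2,3)]) (use 1(5) in \<open>simp_all only: tail_def\<close>)
    qed
    define d where "d x y = h x y - k x y" for x y
    have meask: "case_prod k \<in> borel_measurable (M \<Otimes>\<^sub>M M)"
      using k(1) by (simp add: degenerate_def)
    have measd: "case_prod d \<in> borel_measurable (M \<Otimes>\<^sub>M M)"
      using borel_measurable_diff[OF meas meask] by (simp add: d_def case_prod_unfold)
    from meask have [measurable]: "(\<lambda>z. k (fst z) (snd z)) \<in> borel_measurable (M \<Otimes>\<^sub>M M)"
      by (simp add: case_prod_unfold)
    note [measurable] = measurable_U_coord[OF measd]
    have intk: "integrable (M \<Otimes>\<^sub>M M) (case_prod k)"
      by (rule MM.integrable_const_bound[where B="4 * real (Suc c)"])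
         (use k(2) meask in \<open>auto intro!: AE_I2 simp: space_pair_measure simp del: of_nat_Suc\<close>)
    \<comment> \<open>A bounded kernel has moments of every order. Any exponent strictly between 1
      and 2 would do; \<open>3 / 2\<close> gives the rate n^(4/3), which is at most n^2.\<close>
    have "integrable (M \<Otimes>\<^sub>M M) (\<lambda>z. \<bar>k (fst z) (snd z)\<bar> powr (3/2))"
      by (rule MM.integrable_const_bound[where B="(4 * real (Suc c)) powr (3/2)"])
         (use k(2) in \<open>auto intro!: AE_I2 powr_mono2 simp: space_pair_measure simp del: of_nat_Suc\<close>)
    then have "AE \<omega> in iid. (\<lambda>n. \<bar>U_coord k n \<omega>\<bar> / real n powr (2 / (3/2))) \<longlonglongrightarrow> 0"
      by (intro U_coord_tendsto_zero_gt_1 k) auto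
    then have k0: "AE \<omega> in iid. \<forall>\<^sub>F n in sequentially. \<bar>U_coord k n \<omega>\<bar> \<le> x * (real n)\<^sup>2"
    proof eventually_elim
      case (elim \<omega>)
      have "\<forall>\<^sub>F n in sequentially. \<bar>U_coord k n \<omega>\<bar> / real n powr (2 / (3/2)) < x"
        using order_tendstoD(2)[OF elim \<open>x > 0\<close>] .
      then show ?case
        using eventually_ge_at_top[of 1]
      proof eventually_elim
        case (elim n)
        then have "\<bar>U_coord k n \<omega>\<bar> \<le> x * real n powr (2 / (3/2))" by (simp add: field_simps)
        also have "\<dots> \<le> x * real n powr 2"
          using elim \<open>x > 0\<close> by (intro mult_left_mono powr_mono) auto
        finally show ?case using elim by simp
      qed
    qed
    let ?D = "{\<omega> \<in> space iid. \<exists>n\<ge>1. \<bar>U_coord d n \<omega>\<bar> > x * (real n)\<^sup>2}"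
    have D: "?D \<in> sets iid"
    proof -
      have "{\<omega> \<in> space iid. \<exists>n\<in>{1..}. \<bar>U_coord d n \<omega>\<bar> > x * (real n)\<^sup>2} \<in> sets iid" by measurable
      then show ?thesis by (simp add: Bex_def)
    qed
    have "AE \<omega> in iid. \<omega> \<in> L x \<longrightarrow> \<omega> \<in> ?D"
      using k0
    proof eventually_elim
      case (elim \<omega>)
      show ?case
      proof
        assume L: "\<omega> \<in> L x"
        then have "\<exists>\<^sub>\<infinity>n. \<bar>U_coord h n \<omega>\<bar> > 2 * x * (real n)\<^sup>2" by (simp add: L_def)
        then have "\<exists>\<^sub>\<infinity>n. \<bar>U_coord h n \<omega>\<bar> > 2 * x * (real n)\<^sup>2 \<and> (\<bar>U_coord k n \<omega>\<bar> \<le> x * (real n)\<^sup>2 \<and> n \<ge> 1)"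
          using eventually_conj[OF elim eventually_ge_at_top[of 1]]
          by (simp add: cofinite_eq_sequentially frequently_eventually_frequently)
        then obtain n where "\<bar>U_coord h n \<omega>\<bar> > 2 * x * (real n)\<^sup>2" "\<bar>U_coord k n \<omega>\<bar> \<le> x * (real n)\<^sup>2" "n \<ge> 1"
          by (auto dest: INFM_EX)
        moreover have "U_coord d n \<omega> = U_coord h n \<omega> - U_coord k n \<omega>"
          unfolding d_def by (rule U_coord_diff)
        ultimately have "\<bar>U_coord d n \<omega>\<bar> > x * (real n)\<^sup>2" by linarith
        with \<open>n \<ge> 1\<close> L show "\<omega> \<in> ?D" by (auto simp: L_def)
      qed
    qed
    then have "measure iid (L x) \<le> measure iid ?D"
      using D by (rule iid.finite_measure_mono_AE)
    then have "x * measure iid (L x) \<le> x * measure iid ?D"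
      using \<open>x > 0\<close> by simp
    also have "\<dots> \<le> (\<integral>z. \<bar>d (fst z) (snd z)\<bar> \<partial>(M \<Otimes>\<^sub>M M))"
    proof (rule maximal_inequality_symmetric_all[OF measd _ _ \<open>x > 0\<close>])
      show "d x y = d y x" if "x \<in> space M" "y \<in> space M" for x y
        using h k(1) that unfolding degenerate_def d_def by metis
      show "integrable (M \<Otimes>\<^sub>M M) (case_prod d)"
        using inth intk by (simp add: d_def case_prod_unfold)
    qed
    also have "\<dots> \<le> 4 * tail c" unfolding d_def by (rule k(3))
    finally show ?thesis .
  qed
  have "measure iid (L x) = 0" if "x > 0" for x
  proof -
    have "(\<lambda>c. 4 * tail c) \<longlonglongrightarrow> 4 * 0" using tail0 by (intro tendsto_mult_left)
    then have "x * measure iid (L x) \<le> 4 * 0"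
      by (rule LIMSEQ_le_const) (use bound[OF that] in auto)
    then show ?thesis using that by (simp add: mult_le_0_iff measure_le_0_iff)
  qed
  then have "AE \<omega> in iid. \<omega> \<notin> L (1 / real (Suc j) / 2)" for j
    by (intro AE_not_in) (simp add: null_sets_def iid.emeasure_eq_measure L)
  then have "AE \<omega> in iid. \<forall>j. \<omega> \<notin> L (1 / real (Suc j) / 2)"
    by (simp add: AE_all_countable)
  then show ?thesis
    using AE_space
  proof eventually_elim
    case (elim \<omega>)
    show ?case
    proof (rule tendsto_zero_if_eventually_le)
      fix j
      have "\<forall>\<^sub>F n in sequentially. \<not> \<bar>U_coord h n \<omega>\<bar> > 1 / real (Suc j) * (real n)\<^sup>2"
      proof -
        have e: "2 * (1 / real (Suc j) / 2) * q = 1 / real (Suc j) * q" for q :: real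
          by (simp del: of_nat_Suc)
        have "\<omega> \<notin> L (1 / real (Suc j) / 2)" "\<omega> \<in> space iid" using elim by blast+
        then show ?thesis
          unfolding L_def e by (simp add: cofinite_eq_sequentially not_frequently del: of_nat_Suc)
      qed
      then show "\<forall>\<^sub>F n in sequentially. \<bar>U_coord h n \<omega>\<bar> / (real n)\<^sup>2 \<le> 1 / real (Suc j)"
        using eventually_ge_at_top[of 1]
        by eventually_elim (simp add: not_less divide_le_eq)
    qed simp
  qed
qed

theorem U_coord_tendsto_zero:
  assumes h: "degenerate h" and p: "1 \<le> p" "p < 2"
    and int: "integrable (M \<Otimes>\<^sub>M M) (\<lambda>z. \<bar>h (fst z) (snd z)\<bar> powr p)"
  shows "AE \<omega> in iid. (\<lambda>n. \<bar>U_coord h n \<omega>\<bar> / real n powr (2 / p)) \<longlonglongrightarrow> 0"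
proof (cases "p = 1")
  case True
  have "real n powr (2 / p) = (real n)\<^sup>2" for n using True by simp
  then show ?thesis using U_coord_tendsto_zero_1[OF h integrable_kernel_of_powr[OF h p(1) int]] by simp
next
  case False
  then show ?thesis using assms by (intro U_coord_tendsto_zero_gt_1) auto
qed

text \<open>Taking the maximum with 1 secures a constant of at least 1 and at the same time covers
  \<open>p = 1\<close>, where exchangeability gives the constant 1.\<close>

theorem weak_type_inequality:
  assumes h: "degenerate h" and p: "1 \<le> p" "p < 2"
    and int: "integrable (M \<Otimes>\<^sub>M M) (\<lambda>z. \<bar>h (fst z) (snd z)\<bar> powr p)"
    and "x > 0"
  shows "x powr p * measure iid {\<omega> \<in> space iid. U_max p h (\<lambda>i \<omega>. \<omega> i) \<omega> > ereal x} \<le>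
    max 1 (block_const p) * (\<integral>z. \<bar>h (fst z) (snd z)\<bar> powr p \<partial>(M \<Otimes>\<^sub>M M))"
    (is "_ * measure iid ?A \<le> _ * ?I")
proof -
  have I: "?I \<ge> 0" by simp
  have A: "?A = {\<omega> \<in> space iid. \<exists>n\<ge>1. \<bar>U_coord h n \<omega>\<bar> > x * real n powr (2 / p)}"
    using p by (simp add: U_max_gt_iff)
  show ?thesis
  proof (cases "p = 1")
    case True
    have meas: "case_prod h \<in> borel_measurable (M \<Otimes>\<^sub>M M)"
      and sym: "\<And>x y. x \<in> space M \<Longrightarrow> y \<in> space M \<Longrightarrow> h x y = h y x"
      using h unfolding degenerate_def by blast+
    have sq: "real n powr (2 / p) = (real n)\<^sup>2" for n using True by simp
    have "x powr p * measure iid ?A = x * measure iid {\<omega> \<in> space iid. \<exists>n\<ge>1. \<bar>U_coord h n \<omega>\<bar> > x * (real n)\<^sup>2}"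
      unfolding A sq using True \<open>x > 0\<close> by simp
    also have "\<dots> \<le> (\<integral>z. \<bar>h (fst z) (snd z)\<bar> \<partial>(M \<Otimes>\<^sub>M M))"
      by (rule maximal_inequality_symmetric_all[OF meas sym integrable_kernel_of_powr[OF h p(1) int] \<open>x > 0\<close>])
    also have "\<dots> = 1 * ?I" using True by simp
    also have "\<dots> \<le> max 1 (block_const p) * ?I" using I by (intro mult_right_mono) auto
    finally show ?thesis .
  next
    case False
    then have "1 < p" using p by simp
    note hyps = h \<open>1 < p\<close> p(2) \<open>x > 0\<close> int
    have "?A \<subseteq> (\<Union>N. block_event p h x N)"
    proof
      fix \<omega> assume "\<omega> \<in> ?A"
      then obtain n where n: "\<omega> \<in> space iid" "n \<ge> 1" "\<bar>U_coord h n \<omega>\<bar> > x * real n powr (2 / p)"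
        unfolding A by auto
      then obtain N where "2 ^ N \<le> n" "n < 2 ^ (N + 1)" using ex_power_ivl1[of 2 n] by auto
      with n show "\<omega> \<in> (\<Union>N. block_event p h x N)" by (force simp: block_event_def)
    qed
    then have "measure iid ?A \<le> measure iid (\<Union>N. block_event p h x N)"
      by (intro iid.finite_measure_mono sets.countable_UN) (auto intro: sets_block_event[OF h])
    also have "\<dots> \<le> (\<Sum>N. measure iid (block_event p h x N))"
      by (intro iid.finite_measure_subadditive_countably summable_prob_block_event hyps)
         (auto intro: sets_block_event[OF h])
    also have "\<dots> \<le> block_const p * ?I / x powr p"
      by (intro suminf_le_const summable_prob_block_event sum_prob_block_event_le hyps)
    finally have "x powr p * measure iid ?A \<le> block_const p * ?I"
      using \<open>x > 0\<close> by (simp add: field_simps)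
    also have "\<dots> \<le> max 1 (block_const p) * ?I" using I by (intro mult_right_mono) auto
    finally show ?thesis .
  qed
qed

section \<open>From the product model to an arbitrary sequence\<close>

lemma
  fixes f :: "'a \<Rightarrow> real"
  assumes f: "f \<in> borel_measurable M"
  shows integrable_coordinate_iff: "integrable iid (\<lambda>\<omega>. f (\<omega> i)) \<longleftrightarrow> integrable M f"
    and integral_coordinate: "(\<integral>\<omega>. f (\<omega> i) \<partial>iid) = (\<integral>y. f y \<partial>M)"
proof -
  have d: "distr iid M (\<lambda>\<omega>. \<omega> i) = M"
    by (intro distr_PiM_component) (auto simp: prob_space_axioms)
  show "integrable iid (\<lambda>\<omega>. f (\<omega> i)) \<longleftrightarrow> integrable M f"
    using integrable_distr_eq[of "\<lambda>\<omega>. \<omega> i" iid M f] f by (simp add: d)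
  show "(\<integral>\<omega>. f (\<omega> i) \<partial>iid) = (\<integral>y. f y \<partial>M)"
    using integral_distr[of "\<lambda>\<omega>. \<omega> i" iid M f] f by (simp add: d)
qed

lemma degenerateI:
  assumes meas: "case_prod h \<in> borel_measurable (M \<Otimes>\<^sub>M M)"
    and sym: "\<And>x y. x \<in> space M \<Longrightarrow> y \<in> space M \<Longrightarrow> h x y = h y x"
    and deg: "\<And>x. x \<in> space M \<Longrightarrow> integrable iid (\<lambda>\<omega>. h (\<omega> 0) x) \<and> (\<integral>\<omega>. h (\<omega> 0) x \<partial>iid) = 0"
  shows "degenerate h"
  unfolding degenerate_def
proof (intro conjI ballI)
  fix x assume x: "x \<in> space M"
  have m: "(\<lambda>y. h y x) \<in> borel_measurable M"
    using measurable_compose[OF measurable_Pair2'[OF x] meas] by simp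
  show "integrable M (\<lambda>y. h y x)" "(\<integral>y. h y x \<partial>M) = 0"
    using deg[OF x] integrable_coordinate_iff[OF m, of 0] integral_coordinate[OF m, of 0] by simp_all
qed (use meas sym in auto)

lemma sets_U_max_gt:
  assumes meas: "case_prod h \<in> borel_measurable (M \<Otimes>\<^sub>M M)" and "p > 0"
  shows "{\<omega> \<in> space iid. U_max p h (\<lambda>i \<omega>. \<omega> i) \<omega> > ereal x} \<in> sets iid"
proof -
  note [measurable] = measurable_U_coord[OF meas]
  have "{\<omega> \<in> space iid. \<exists>n\<in>{1..}. \<bar>U_coord h n \<omega>\<bar> > x * real n powr (2 / p)} \<in> sets iid"
    by measurable
  then show ?thesis using \<open>p > 0\<close> by (simp add: U_max_gt_iff Bex_def)
qed

text \<open>The bridge from a given i.i.d. sequence to the coordinate model: events and integrals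
  carry over by one change of variables. The measures \<open>\<nu>\<close> and \<open>N\<close>
  share their measurable sets, which identifies the sigma-algebras of the two products.\<close>

lemma distr_sequence_eq_PiM:
  assumes indep: "indep_vars (\<lambda>_. N) X (UNIV :: int set)"
    and ident: "\<And>i. distr M N (X i) = \<nu>"
  shows "(\<lambda>\<omega> i. X i \<omega>) \<in> M \<rightarrow>\<^sub>M Pi\<^sub>M UNIV (\<lambda>_. \<nu>)"
    and "distr M (Pi\<^sub>M UNIV (\<lambda>_. \<nu>)) (\<lambda>\<omega> i. X i \<omega>) = Pi\<^sub>M UNIV (\<lambda>_. \<nu>)"
proof -
  have X: "X i \<in> M \<rightarrow>\<^sub>M N" for i using indep by (simp add: indep_vars_def)
  have sets: "sets \<nu> = sets N" unfolding ident[of 0, symmetric] by simp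
  then have sets': "sets (Pi\<^sub>M UNIV (\<lambda>_. \<nu>)) = sets (Pi\<^sub>M UNIV (\<lambda>_. N))" for UNIV :: "int set"
    by (intro sets_PiM_cong) auto
  have "(\<lambda>\<omega>. \<lambda>i\<in>UNIV. X i \<omega>) \<in> M \<rightarrow>\<^sub>M Pi\<^sub>M UNIV (\<lambda>_. N)"
    by (intro measurable_restrict X)
  then show "(\<lambda>\<omega> i. X i \<omega>) \<in> M \<rightarrow>\<^sub>M Pi\<^sub>M UNIV (\<lambda>_. \<nu>)"
    by (simp add: measurable_cong_sets[OF refl sets'] restrict_def)
  have "distr M (Pi\<^sub>M UNIV (\<lambda>_. N)) (\<lambda>\<omega>. \<lambda>i\<in>UNIV. X i \<omega>) = Pi\<^sub>M UNIV (\<lambda>i. distr M N (X i))"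
    using indep_vars_iff_distr_eq_PiM[where I=UNIV and M'="\<lambda>_. N" and X=X] X indep by auto
  then show "distr M (Pi\<^sub>M UNIV (\<lambda>_. \<nu>)) (\<lambda>\<omega> i. X i \<omega>) = Pi\<^sub>M UNIV (\<lambda>_. \<nu>)"
    by (simp add: ident restrict_def distr_cong[OF refl sets'])
qed

end

text \<open>The weak-type bound holds over every probability space with a constant built from
  \<open>p\<close> alone, so it applies to all dimensions and laws at once. The existence of such a
  constant is what gives content to the choice in \<open>weak_type_const\<close>.\<close>

lemma is_weak_type_const_block_const:
  assumes "1 \<le> p" "p < 2"
  shows "is_weak_type_const p (max 1 (block_const p))"
  unfolding is_weak_type_const_def
proof (intro conjI allI impI)
  fix d :: nat and \<mu> :: "(nat \<Rightarrow> real) measure" and h :: "(nat \<Rightarrow> real) \<Rightarrow> (nat \<Rightarrow> real) \<Rightarrow> real" and t :: real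
  let ?P = "\<Pi>\<^sub>M i\<in>(UNIV::int set). \<mu>"
  assume \<mu>: "prob_space \<mu>" and meas: "(\<lambda>(x, y). h x y) \<in> borel_measurable (\<mu> \<Otimes>\<^sub>M \<mu>)"
    and sym: "\<forall>x\<in>space \<mu>. \<forall>y\<in>space \<mu>. h x y = h y x"
    and int: "integrable ?P (\<lambda>\<omega>. \<bar>h (\<omega> 0) (\<omega> 1)\<bar> powr p)"
    and deg: "\<forall>x\<in>space \<mu>. integrable ?P (\<lambda>\<omega>. h (\<omega> 0) x) \<and> (\<integral>\<omega>. h (\<omega> 0) x \<partial>?P) = 0"
    and "t > 0"
  interpret prob_space \<mu> by fact
  have h: "degenerate h" using meas sym deg by (intro degenerateI) auto
  have measp: "case_prod (\<lambda>x y. \<bar>h x y\<bar> powr p) \<in> borel_measurable (\<mu> \<Otimes>\<^sub>M \<mu>)"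
    using meas by (simp add: case_prod_unfold)
  have "integrable (\<mu> \<Otimes>\<^sub>M \<mu>) (\<lambda>z. \<bar>h (fst z) (snd z)\<bar> powr p)"
    using int integrable_coordinate_pair_iff[OF _ measp, of 0 1] by simp
  from weak_type_inequality[OF h assms this \<open>t > 0\<close>]
  show "t powr p * measure ?P {\<omega> \<in> space ?P. U_max p h (\<lambda>i \<omega>. \<omega> i) \<omega> > ereal t}
      \<le> max 1 (block_const p) * (\<integral>\<omega>. \<bar>h (\<omega> 0) (\<omega> 1)\<bar> powr p \<partial>?P)"
    using integral_coordinate_pair[OF _ measp, of 0 1] by simp
qed simp

theorem proposition1p2:
  fixes M :: "'a measure"
    and \<epsilon> :: "int \<Rightarrow> 'a \<Rightarrow> real ^ 'n"
    and h :: "real ^ 'n \<Rightarrow> real ^ 'n \<Rightarrow> real"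
    and p :: real
  assumes "prob_space M"
    and "prob_space.indep_vars M (\<lambda>_. borel) \<epsilon> UNIV"
    and "\<And>i. distr M borel (\<epsilon> i) = distr M borel (\<epsilon> 0)"
    and "(\<lambda>(x, y). h x y) \<in> borel_measurable (borel \<Otimes>\<^sub>M borel)"
    and "\<And>x y. h x y = h y x"
    and "1 \<le> p" and "p < 2"
    and "integrable M (\<lambda>\<omega>. \<bar>h (\<epsilon> 0 \<omega>) (\<epsilon> 1 \<omega>)\<bar> powr p)"
    and "\<And>x. integrable M (\<lambda>\<omega>. h (\<epsilon> 0 \<omega>) x)"
    and "\<And>x. integral\<^sup>L M (\<lambda>\<omega>. h (\<epsilon> 0 \<omega>) x) = 0"
  shows "(AE \<omega> in M. (\<lambda>n. \<bar>U_stat h \<epsilon> n \<omega>\<bar> / real n powr (2 / p)) \<longlonglongrightarrow> 0) \<and>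
    weak_type_const p \<ge> 1 \<and>
    (\<forall>x>0. x powr p * measure M {\<omega> \<in> space M. U_max p h \<epsilon> \<omega> > ereal x}
        \<le> weak_type_const p * integral\<^sup>L M (\<lambda>\<omega>. \<bar>h (\<epsilon> 0 \<omega>) (\<epsilon> 1 \<omega>)\<bar> powr p))"
proof -
  interpret prob_space M by fact
  have \<epsilon>[measurable]: "\<epsilon> i \<in> borel_measurable M" for i
    using assms(2) by (simp add: indep_vars_def)
  note h_meas[measurable] = assms(4)
  have wtc: "is_weak_type_const p (weak_type_const p)"
    unfolding weak_type_const_def using is_weak_type_const_block_const[OF assms(6,7)] by (rule someI)

  \<comment> \<open>Convergence involves no constant, so it is transferred directly from the product
    of copies of the law \<open>\<nu>\<close> on \<open>real ^ 'n\<close>.\<close>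
  have conv: "AE \<omega> in M. (\<lambda>n. \<bar>U_stat h \<epsilon> n \<omega>\<bar> / real n powr (2 / p)) \<longlonglongrightarrow> 0"
  proof -
    define \<nu> where "\<nu> = distr M borel (\<epsilon> 0)"
    interpret \<nu>: prob_space \<nu> unfolding \<nu>_def by (rule prob_space_distr) simp
    note X = distr_sequence_eq_PiM[OF assms(2), of \<nu>, unfolded \<nu>_def, OF assms(3), folded \<nu>_def]
    have [measurable_cong]: "sets \<nu> = sets borel" by (simp add: \<nu>_def)
    have meas: "case_prod h \<in> borel_measurable (\<nu> \<Otimes>\<^sub>M \<nu>)" by measurable
    have measp: "case_prod (\<lambda>x y. \<bar>h x y\<bar> powr p) \<in> borel_measurable (\<nu> \<Otimes>\<^sub>M \<nu>)"
      using meas by (simp add: case_prod_unfold)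
    have deg: "\<nu>.degenerate h"
      unfolding \<nu>.degenerate_def
    proof (intro conjI ballI meas assms(5))
      fix x
      have [measurable]: "(\<lambda>y. h y x) \<in> borel_measurable borel"
        using measurable_compose[OF measurable_Pair2'[of x borel borel] h_meas] by simp
      show "integrable \<nu> (\<lambda>y. h y x)"
        unfolding \<nu>_def using assms(9) by (simp add: integrable_distr_eq)
      show "(\<integral>y. h y x \<partial>\<nu>) = 0"
        unfolding \<nu>_def using assms(10) by (simp add: integral_distr)
    qed
    have "integrable (distr M (Pi\<^sub>M UNIV (\<lambda>_. \<nu>)) (\<lambda>\<omega> i. \<epsilon> i \<omega>)) (\<lambda>\<omega>. \<bar>h (\<omega> 0) (\<omega> 1)\<bar> powr p)"
      using assms(8) \<nu>.measurable_coordinate_pair[OF measp] by (subst integrable_distr_eq[OF X(1)]) auto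
    then have "integrable (\<nu> \<Otimes>\<^sub>M \<nu>) (\<lambda>z. \<bar>h (fst z) (snd z)\<bar> powr p)"
      unfolding X(2) using \<nu>.integrable_coordinate_pair_iff[OF _ measp, of 0 1] by simp
    from \<nu>.U_coord_tendsto_zero[OF deg assms(6,7) this]
    have "AE \<omega> in distr M (Pi\<^sub>M UNIV (\<lambda>_. \<nu>)) (\<lambda>\<omega> i. \<epsilon> i \<omega>).
        (\<lambda>n. \<bar>U_coord h n \<omega>\<bar> / real n powr (2 / p)) \<longlonglongrightarrow> 0"
      unfolding X(2) .
    from AE_distrD[OF X(1) this] show ?thesis by (simp add: U_stat_def)
  qed

  \<comment> \<open>The chosen constant is known only through \<open>is_weak_type_const\<close>,
    which speaks of laws on functions over \<open>{..<d}\<close>. The sequence is therefore encoded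
    by \<open>\<phi>\<close>, and the kernel is pulled back along the decoding
    \<open>\<psi>\<close>.\<close>
  have "x powr p * measure M {\<omega> \<in> space M. U_max p h \<epsilon> \<omega> > ereal x}
        \<le> weak_type_const p * integral\<^sup>L M (\<lambda>\<omega>. \<bar>h (\<epsilon> 0 \<omega>) (\<epsilon> 1 \<omega>)\<bar> powr p)" if "x > 0" for x
  proof -
    define d where "d = CARD('n)"
    obtain b :: "'n \<Rightarrow> nat" where b: "bij_betw b UNIV {..<d}"
      unfolding d_def using ex_bij_betw_finite_nat[of "UNIV :: 'n set"] by (auto simp: atLeast0LessThan)
    let ?N = "\<Pi>\<^sub>M k\<in>{..<d}. (borel :: real measure)"
    define \<phi> :: "real ^ 'n \<Rightarrow> nat \<Rightarrow> real" where "\<phi> v = (\<lambda>k\<in>{..<d}. v $ inv_into UNIV b k)" for v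
    define \<psi> :: "(nat \<Rightarrow> real) \<Rightarrow> real ^ 'n" where "\<psi> u = (\<Sum>i\<in>UNIV. u (b i) *\<^sub>R axis i 1)" for u
    have b_less: "b i \<in> {..<d}" for i using b by (auto simp: bij_betw_def)
    have \<psi>_nth: "\<psi> u $ i = u (b i)" for u i
      by (simp add: \<psi>_def axis_def if_distrib cong: if_cong)
    \<comment> \<open>Decoding undoes encoding, so the pulled-back kernel along the encoded sequence
      agrees pointwise with \<open>h\<close> along the original one.\<close>
    have \<psi>\<phi>: "\<psi> (\<phi> v) = v" for v
      using b b_less by (simp add: vec_eq_iff \<psi>_nth \<phi>_def bij_betw_def)
    have [measurable]: "\<phi> \<in> borel \<rightarrow>\<^sub>M ?N" unfolding \<phi>_def by measurable
    have [measurable]: "\<psi> \<in> ?N \<rightarrow>\<^sub>M borel"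
      unfolding \<psi>_def using b_less by (intro borel_measurable_sum borel_measurable_scaleR) auto
    define \<mu> where "\<mu> = distr M ?N (\<lambda>\<omega>. \<phi> (\<epsilon> 0 \<omega>))"
    interpret \<mu>: prob_space \<mu> unfolding \<mu>_def by (rule prob_space_distr) simp
    have sets[measurable_cong]: "sets \<mu> = sets ?N" by (simp add: \<mu>_def)
    have "indep_vars (\<lambda>_. ?N) (\<lambda>i \<omega>. \<phi> (\<epsilon> i \<omega>)) UNIV"
      by (rule indep_vars_compose2[OF assms(2)]) simp
    moreover have "distr M ?N (\<lambda>\<omega>. \<phi> (\<epsilon> i \<omega>)) = \<mu>" for i
    proof -
      have "distr M ?N (\<lambda>\<omega>. \<phi> (\<epsilon> i \<omega>)) = distr (distr M borel (\<epsilon> i)) ?N \<phi>" for i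
        by (simp add: distr_distr comp_def)
      then show ?thesis unfolding \<mu>_def using assms(3)[of i] by simp
    qed
    ultimately have X: "(\<lambda>\<omega> i. \<phi> (\<epsilon> i \<omega>)) \<in> M \<rightarrow>\<^sub>M Pi\<^sub>M UNIV (\<lambda>_. \<mu>)"
      and X_distr: "distr M (Pi\<^sub>M UNIV (\<lambda>_. \<mu>)) (\<lambda>\<omega> i. \<phi> (\<epsilon> i \<omega>)) = Pi\<^sub>M UNIV (\<lambda>_. \<mu>)"
      by (rule distr_sequence_eq_PiM)+
    define g where "g u v = h (\<psi> u) (\<psi> v)" for u v
    have meas: "case_prod g \<in> borel_measurable (\<mu> \<Otimes>\<^sub>M \<mu>)"
      unfolding g_def by measurable
    have measp: "case_prod (\<lambda>x y. \<bar>g x y\<bar> powr p) \<in> borel_measurable (\<mu> \<Otimes>\<^sub>M \<mu>)"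
      using meas by (simp add: case_prod_unfold)
    let ?P = "\<Pi>\<^sub>M i\<in>(UNIV::int set). \<mu>"
    have int: "integrable ?P (\<lambda>\<omega>. \<bar>g (\<omega> 0) (\<omega> 1)\<bar> powr p)"
      using assms(8) \<mu>.measurable_coordinate_pair[OF measp]
      by (subst X_distr[symmetric], subst integrable_distr_eq[OF X]) (auto simp: g_def \<psi>\<phi>)
    have int_eq: "(\<integral>\<omega>. \<bar>g (\<omega> 0) (\<omega> 1)\<bar> powr p \<partial>?P) = (\<integral>\<omega>. \<bar>h (\<epsilon> 0 \<omega>) (\<epsilon> 1 \<omega>)\<bar> powr p \<partial>M)"
      using \<mu>.measurable_coordinate_pair[OF measp]
      by (subst X_distr[symmetric], subst integral_distr[OF X]) (auto simp: g_def \<psi>\<phi>)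
    \<comment> \<open>Along the encoded sequence this section is that of \<open>h\<close> at the
      fixed point \<open>\<psi> u\<close>. Since \<open>h\<close> is centred at every point and not
      just at almost every one, each \<open>u\<close> is covered.\<close>
    have deg: "integrable ?P (\<lambda>\<omega>. g (\<omega> 0) u) \<and> (\<integral>\<omega>. g (\<omega> 0) u \<partial>?P) = 0" if u: "u \<in> space \<mu>" for u
    proof -
      have "(\<lambda>y. g y u) \<in> borel_measurable \<mu>"
        using measurable_compose[OF measurable_Pair2'[OF u] meas] by simp
      then have m: "(\<lambda>\<omega>. g (\<omega> 0) u) \<in> borel_measurable ?P"
        by (rule measurable_compose[rotated]) simp
      have "integrable ?P (\<lambda>\<omega>. g (\<omega> 0) u)"
        using m assms(9) by (subst X_distr[symmetric], subst integrable_distr_eq[OF X]) (auto simp: g_def \<psi>\<phi>)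
      moreover have "(\<integral>\<omega>. g (\<omega> 0) u \<partial>?P) = 0"
        using m assms(10) by (subst X_distr[symmetric], subst integral_distr[OF X]) (auto simp: g_def \<psi>\<phi>)
      ultimately show ?thesis by simp
    qed
    let ?A = "{\<omega> \<in> space ?P. U_max p g (\<lambda>i \<omega>. \<omega> i) \<omega> > ereal x}"
    have "x powr p * measure ?P ?A \<le> weak_type_const p * (\<integral>\<omega>. \<bar>g (\<omega> 0) (\<omega> 1)\<bar> powr p \<partial>?P)"
    proof (rule wtc[unfolded is_weak_type_const_def, THEN conjunct2, rule_format])
      show "1 \<le> d" by (simp add: d_def Suc_leI)
      show "prob_space \<mu>" by (rule \<mu>.prob_space_axioms)
      show "sets \<mu> = sets ?N" by (rule sets)
      show "case_prod g \<in> borel_measurable (\<mu> \<Otimes>\<^sub>M \<mu>)" by (rule meas)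
      show "g u v = g v u" for u v unfolding g_def by (rule assms(5))
      show "integrable ?P (\<lambda>\<omega>. \<bar>g (\<omega> 0) (\<omega> 1)\<bar> powr p)" by (rule int)
      show "integrable ?P (\<lambda>\<omega>. g (\<omega> 0) u) \<and> (\<integral>\<omega>. g (\<omega> 0) u \<partial>?P) = 0" if "u \<in> space \<mu>" for u
        by (rule deg[OF that])
    qed (rule \<open>x > 0\<close>)
    moreover have "measure ?P ?A = measure M {\<omega> \<in> space M. U_max p h \<epsilon> \<omega> > ereal x}"
    proof -
      have "?A \<in> sets ?P" using assms(6) by (intro \<mu>.sets_U_max_gt meas) auto
      then have "measure (distr M ?P (\<lambda>\<omega> i. \<phi> (\<epsilon> i \<omega>))) ?A = measure M ((\<lambda>\<omega> i. \<phi> (\<epsilon> i \<omega>)) -` ?A \<inter> space M)"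
        by (rule measure_distr[OF X])
      also have "(\<lambda>\<omega> i. \<phi> (\<epsilon> i \<omega>)) -` ?A \<inter> space M = {\<omega> \<in> space M. U_max p h \<epsilon> \<omega> > ereal x}"
        using measurable_space[OF X] by (auto simp: U_max_def U_stat_def g_def \<psi>\<phi>)
      finally show ?thesis by (simp add: X_distr)
    qed
    ultimately show ?thesis by (simp add: int_eq)
  qed
  moreover have "weak_type_const p \<ge> 1" using wtc by (simp add: is_weak_type_const_def)
  ultimately show ?thesis using conv by blast
qed

end
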